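(* Let $d\ge1$ and let $u_1,\dots,u_{d+1}:\mathbb{R}^d\times\mathbb{R}\to\mathbb{C}$ be solutions of the Schr\"odinger equation $i\partial_tu=\Delta u$ with initial data $f_1,\dots,f_{d+1}$ respectively. Then for all $\sigma\ge0$, $$\int_{\substack{x_1+\cdots+x_{d+1}=0\\ t_1+\cdots+t_{d+1}=0}}\bigl||\rho(\nabla_x)|^{\sigma}\bigl(u_1(x_1,t_1)\cdots u_{d+1}(x_{d+1},t_{d+1})\bigr)\bigr|^2\,dx\,dt=\frac{1}{2^d(2\pi)^{d(d+1)}}\int_{(\mathbb{R}^d)^{d+1}}\frac{|\widehat f_1(\xi_1)|^2\cdots|\widehat f_{d+1}(\xi_{d+1})|^2}{|\rho(\xi)|^{1-2\sigma}}\,d\xi .$$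
   Context: Fourier transform: $\widehat f(\xi)=\int_{\mathbb{R}^d}e^{-ix\cdot\xi}f(x)\,dx$. The data $f_j$ are such that $\widehat f_j\in L^1(\mathbb{R}^d)$ (with $f_j$ the inverse Fourier transform of $\widehat f_j$) and $|\rho(\xi)|^\sigma\widehat f_1(\xi_1)\cdots\widehat f_{d+1}(\xi_{d+1})$ is integrable on $(\mathbb{R}^d)^{d+1}$. The solution with data $f_j$ is $u_j(x,t)=(2\pi)^{-d}\int_{\mathbb{R}^d}e^{i(x\cdot\xi+t|\xi|^2)}\widehat f_j(\xi)\,d\xi$. For $\xi=(\xi_1,\dots,\xi_{d+1})\in(\mathbb{R}^d)^{d+1}$, $$\rho(\xi)=\det\begin{pmatrix}1&\cdots&1\\ \xi_1&\cdots&\xi_{d+1}\end{pmatrix},$$ the determinant of the $(d+1)\times(d+1)$ matrix with $j$-th column $(1,\xi_j)^T$. The operator $|\rho(\nabla_x)|^\sigma$ is the Fourier multiplier operator in the variables $(x_1,\dots,x_{d+1})\in\mathbb{R}^{d(d+1)}$ (with the times $t_j$ fixed) with multiplier $|\rho(\xi)|^\sigma$; that is, $$|\rho(\nabla_x)|^\sigma(u_1(x_1,t_1)\cdots u_{d+1}(x_{d+1},t_{d+1}))=(2\pi)^{-d(d+1)}\int_{(\mathbb{R}^d)^{d+1}}|\rho(\xi)|^\sigma\prod_{j=1}^{d+1}e^{i(x_j\cdot\xi_j+t_j|\xi_j|^2)}\widehat f_j(\xi_j)\,d\xi .$$ It is applied first, and the result is then restricted to the subspace of integration. The integral over $x_1+\cdots+x_{d+1}=0$,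 $t_1+\cdots+t_{d+1}=0$ is with respect to $dx_1\cdots dx_d\,dt_1\cdots dt_d$, with $x_{d+1}=-x_1-\cdots-x_d$ and $t_{d+1}=-t_1-\cdots-t_d$. The identity is understood in $[0,\infty]$. *)

theory Defs
  imports "HOL-Analysis.Analysis"
begin

definition inverse_fourier :: "('a::euclidean_space \<Rightarrow> complex) \<Rightarrow> 'a \<Rightarrow> complex" where
  "inverse_fourier F x =
     complex_of_real (1 / (2 * pi) ^ DIM('a)) *
     (\<integral>\<xi>. exp (\<i> * complex_of_real (x \<bullet> \<xi>)) * F \<xi> \<partial>lborel)"

text \<open>
  The integral formula makes sense for integrable \<open>f\<close> only. For other \<open>f\<close> (for
  example square-integrable data), the transform is the integrable function, unique up to null
  sets, whose inverse transform is \<open>f\<close>; this is the distributional Fourier transform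
  whenever the latter is integrable. If neither applies, the value is unspecified.
\<close>

definition fourier :: "('a::euclidean_space \<Rightarrow> complex) \<Rightarrow> 'a \<Rightarrow> complex" where
  "fourier f =
     (if integrable lborel f
      then (\<lambda>\<xi>. \<integral>x. exp (- (\<i> * complex_of_real (x \<bullet> \<xi>))) * f x \<partial>lborel)
      else (SOME F. integrable lborel F \<and> (AE x in lborel. f x = inverse_fourier F x)))"

definition fourier_multiplier ::
  "('a::euclidean_space \<Rightarrow> complex) \<Rightarrow> ('a \<Rightarrow> complex) \<Rightarrow> 'a \<Rightarrow> complex" where
  "fourier_multiplier m g = inverse_fourier (\<lambda>\<xi>. m \<xi> * fourier g \<xi>)"

text \<open>The solution of \<open>i \<partial>\<^sub>t u = \<Delta> u\<close> with \<open>u(\<cdot>, 0) = f\<close>.\<close>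

definition schroedinger :: "(real ^ 'n \<Rightarrow> complex) \<Rightarrow> real ^ 'n \<Rightarrow> real \<Rightarrow> complex" where
  "schroedinger f x t =
     complex_of_real (1 / (2 * pi) ^ CARD('n)) *
     (\<integral>\<xi>. exp (\<i> * complex_of_real (x \<bullet> \<xi> + t * (norm \<xi>)\<^sup>2)) * fourier f \<xi> \<partial>lborel)"

text \<open>
  With \<open>d = CARD('n)\<close>, the \<open>d + 1\<close> indices are the elements of \<open>'n option\<close>:
  as a column index \<open>None\<close> stands for \<open>d + 1\<close>, and as a row index for the row of ones.
  The sign of the determinant depends on how rows and columns are matched up; only its absolute
  value is used.
\<close>

definition rho :: "(real ^ 'n) ^ ('n option) \<Rightarrow> real" where
  "rho \<xi> = det (\<chi> r j. case r of None \<Rightarrow> 1 | Some k \<Rightarrow> \<xi> $ j $ k)"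

text \<open>
  The point \<open>(y\<^sub>1, \<dots>, y\<^sub>d, - y\<^sub>1 - \<dots> - y\<^sub>d)\<close> of the subspace where the
  \<open>d + 1\<close> components sum to zero.
\<close>

definition zero_sum :: "'a::real_vector ^ 'n \<Rightarrow> 'a ^ ('n option)" where
  "zero_sum y = (\<chi> j. case j of None \<Rightarrow> - (\<Sum>i\<in>UNIV. y $ i) | Some i \<Rightarrow> y $ i)"

text \<open>
  \<open>|\<rho>(\<nabla>\<^sub>x)|\<^sup>\<sigma>\<close>. For \<open>\<sigma> = 0\<close> the convention \<open>0 powr 0 = 0\<close> concerns only the
  null set where \<open>rho\<close> vanishes.
\<close>

definition rho_nabla_powr ::
  "real \<Rightarrow> ((real ^ 'n) ^ ('n option) \<Rightarrow> complex) \<Rightarrow> (real ^ 'n) ^ ('n option) \<Rightarrow> complex" where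
  "rho_nabla_powr \<sigma> = fourier_multiplier (\<lambda>\<xi>. complex_of_real (\<bar>rho \<xi>\<bar> powr \<sigma>))"

end

theory Submission
  imports Defs "HOL-Probability.Characteristic_Functions" "HOL-Computational_Algebra.Polynomial"
begin

text \<open>
  On the subspace \<open>x\<^sub>1 + \<dots> + x\<^bsub>d+1\<^esub> = 0\<close>, \<open>t\<^sub>1 + \<dots> + t\<^bsub>d+1\<^esub> = 0\<close> the phase
  \<open>\<Sum>\<^sub>j (x\<^sub>j \<bullet> \<xi>\<^sub>j + t\<^sub>j |\<xi>\<^sub>j|\<^sup>2)\<close> is the inner product of the free variables \<open>(x, t)\<close> with
  \<open>(v, \<tau>)\<close>, where \<open>v\<^sub>i = \<xi>\<^sub>i - \<xi>\<^bsub>d+1\<^esub>\<close> and \<open>\<tau>\<^sub>i = |\<xi>\<^sub>i|\<^sup>2 - |\<xi>\<^bsub>d+1\<^esub>|\<^sup>2 = |v\<^sub>i|\<^sup>2 + 2 v\<^sub>i \<bullet> \<xi>\<^bsub>d+1\<^esub>\<close>.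
  For fixed \<open>v\<close> the last expression is affine in \<open>\<xi>\<^bsub>d+1\<^esub>\<close>, so \<open>\<xi> \<mapsto> (v, \<tau>)\<close> is injective off the null
  set \<open>\<rho> = 0\<close> with Jacobian \<open>2\<^sup>d |det v| = 2\<^sup>d |\<rho>(\<xi>)|\<close>, and Plancherel's identity in the variables
  \<open>(v, \<tau>)\<close> gives the result.

  Plancherel's identity for integrable \<open>P\<close>, with values in \<open>[0, \<infinity>]\<close>, and the inversion formula both come from
  the fact that damping the transform of \<open>P\<close> by a Gaussian and transforming back yields a Gaussian
  average of \<open>P\<close>, and these averages converge to \<open>P\<close> in \<open>L\<^sup>1\<close>. Fatou's lemma removes the damping.
\<close>

section \<open>Gaussian integrals\<close>

text \<open>Plancherel is applied to the amplitude |rho|^\<sigma> times the product of the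
  transforms of the data, carried to (v, \<tau>) together with the Jacobian weight 1 / (2^d |rho|).
  The square contains this weight twice. One copy is spent on changing variables back; the other
  survives and produces both the factor 1 / 2^d and the exponent 1 - 2 \<sigma>. The squared
  normalisation of the multiplier gives (2 pi)^(-2 d (d + 1)), and Plancherel in dimension d^2 + d
  gives back (2 pi)^(d (d + 1)).

  Two obstacles shape the proof. The amplitude is only known to be integrable, so its L^2 norm may
  be infinite; Plancherel is therefore proved as two inequalities in [0, \<infinity>], the lower one
  by applying the upper one to the damped transform. Moreover, the multiplier applies
  \<open>fourier\<close> to a product of solutions that need not be integrable, where
  \<open>fourier\<close> is merely a chosen function; that an integrable function is determined up
  to null sets by its inverse transform shows that the choice is the expected one.\<close>

lemma gaussian_fourier_real:
  fixes s a :: real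
  assumes s: "s > 0"
  shows "integrable lborel (\<lambda>t. exp (\<i> * complex_of_real (t * a)) * complex_of_real (exp (- ((s * t)\<^sup>2 / 2))))"
    and "(\<integral>t. exp (\<i> * complex_of_real (t * a)) * complex_of_real (exp (- ((s * t)\<^sup>2 / 2))) \<partial>lborel)
      = complex_of_real (sqrt (2 * pi) / s * exp (- ((a / s)\<^sup>2 / 2)))"
proof -
  let ?f = "\<lambda>x. exp (\<i> * complex_of_real (a / s * x)) * complex_of_real (exp (- (x\<^sup>2 / 2)))"
  have "integrable lborel (\<lambda>x. std_normal_density x)"
    using integrable_std_normal_moment[of 0] by simp
  from integrable_mult_right[OF this, of "sqrt (2 * pi)"]
  have i0: "integrable lborel (\<lambda>x::real. exp (- (x\<^sup>2 / 2)))"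
    by (simp add: std_normal_density_def)
  have f: "integrable lborel ?f"
    by (rule Bochner_Integration.integrable_bound[OF i0]) (auto simp: norm_mult)
  \<comment> \<open>The value comes from the characteristic function of the standard normal
    distribution at \<open>a / s\<close>; the substitution x = s t then brings in the width and the
    factor 1 / s.\<close>
  have "complex_of_real (exp (- (a / s)\<^sup>2 / 2)) = char std_normal_distribution (a / s)"
    by (simp add: char_std_normal_distribution)
  also have "\<dots> = (\<integral>x. std_normal_density x *\<^sub>R exp (\<i> * complex_of_real (a / s * x)) \<partial>lborel)"
    unfolding char_def by (subst integral_density) auto
  also have "\<dots> = (\<integral>x. complex_of_real (1 / sqrt (2 * pi)) * ?f x \<partial>lborel)"
    by (intro Bochner_Integration.integral_cong)
      (simp_all add: std_normal_density_def scaleR_conv_of_real ac_simps)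
  also have "\<dots> = complex_of_real (1 / sqrt (2 * pi)) * (\<integral>x. ?f x \<partial>lborel)"
    by simp
  finally have F: "(\<integral>x. ?f x \<partial>lborel) = complex_of_real (sqrt (2 * pi) * exp (- ((a / s)\<^sup>2 / 2)))"
    by (simp add: field_simps)
  have eq: "?f (0 + s * t) = exp (\<i> * complex_of_real (t * a)) * complex_of_real (exp (- ((s * t)\<^sup>2 / 2)))" for t
    using s by (simp add: mult.commute)
  show "integrable lborel (\<lambda>t. exp (\<i> * complex_of_real (t * a)) * complex_of_real (exp (- ((s * t)\<^sup>2 / 2))))"
    using lborel_integrable_real_affine[OF f, of s 0] s unfolding eq by simp
  show "(\<integral>t. exp (\<i> * complex_of_real (t * a)) * complex_of_real (exp (- ((s * t)\<^sup>2 / 2))) \<partial>lborel)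
      = complex_of_real (sqrt (2 * pi) / s * exp (- ((a / s)\<^sup>2 / 2)))"
    using lborel_integral_real_affine[of s ?f 0] s F unfolding eq
    by (simp add: scaleR_conv_of_real field_simps)
qed

lemma
  fixes f :: "'a::euclidean_space \<Rightarrow> real \<Rightarrow> 'b::{real_normed_field,banach,second_countable_topology}"
  assumes f: "\<And>b. b \<in> Basis \<Longrightarrow> integrable lborel (f b)"
  shows integrable_lborel_prod: "integrable lborel (\<lambda>x. \<Prod>b\<in>Basis. f b (x \<bullet> b))"
    and integral_lborel_prod:
      "(\<integral>x. (\<Prod>b\<in>Basis. f b (x \<bullet> b)) \<partial>lborel) = (\<Prod>b\<in>Basis. \<integral>x. f b x \<partial>lborel)"
proof -
  interpret product_sigma_finite "\<lambda>_::'a. lborel :: real measure" ..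
  have [measurable]: "f b \<in> borel_measurable borel" if "b \<in> Basis" for b
    using f[OF that] by (auto dest: borel_measurable_integrable)
  have eq: "(\<Prod>b\<in>Basis. f b ((\<Sum>b\<in>Basis. g b *\<^sub>R b) \<bullet> b)) = (\<Prod>b\<in>Basis. f b (g b))" for g
    by (intro prod.cong) (simp_all add: inner_sum_left_Basis)
  show "integrable lborel (\<lambda>x. \<Prod>b\<in>Basis. f b (x \<bullet> b))"
    by (subst lborel_eq, subst integrable_distr_eq)
       (simp_all add: eq product_integrable_prod f cong: measurable_cong)
  show "(\<integral>x. (\<Prod>b\<in>Basis. f b (x \<bullet> b)) \<partial>lborel) = (\<Prod>b\<in>Basis. \<integral>x. f b x \<partial>lborel)"
    by (subst lborel_eq, subst integral_distr)
       (simp_all add: eq product_integral_prod f)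
qed

text \<open>Oscillation and Gaussian both factor over the coordinates, so the integral is a product
  of one-dimensional ones.\<close>

lemma
  fixes v :: "'a::euclidean_space" and s :: real
  assumes s: "s > 0"
  shows integrable_gaussian_fourier:
      "integrable lborel (\<lambda>y::'a. exp (\<i> * complex_of_real (y \<bullet> v)) * complex_of_real (exp (- ((s * norm y)\<^sup>2 / 2))))"
    and gaussian_fourier:
      "(\<integral>y. exp (\<i> * complex_of_real (y \<bullet> v)) * complex_of_real (exp (- ((s * norm y)\<^sup>2 / 2))) \<partial>lborel)
      = complex_of_real ((sqrt (2 * pi) / s) ^ DIM('a) * exp (- ((norm v / s)\<^sup>2 / 2)))"
proof -
  have norm2: "(norm x)\<^sup>2 = (\<Sum>b\<in>Basis. (x \<bullet> b)\<^sup>2)" for x :: 'a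
    unfolding power2_norm_eq_inner by (subst euclidean_inner) (simp add: power2_eq_square)
  let ?g = "\<lambda>(b::'a) t. exp (\<i> * complex_of_real (t * (v \<bullet> b))) * complex_of_real (exp (- ((s * t)\<^sup>2 / 2)))"
  have eq: "exp (\<i> * complex_of_real (y \<bullet> v)) * complex_of_real (exp (- ((s * norm y)\<^sup>2 / 2)))
      = (\<Prod>b\<in>Basis. ?g b (y \<bullet> b))" for y
  proof -
    have "exp (\<i> * complex_of_real (y \<bullet> v)) = (\<Prod>b\<in>Basis. exp (\<i> * complex_of_real ((y \<bullet> b) * (v \<bullet> b))))"
      by (simp add: euclidean_inner[of y v] sum_distrib_left flip: exp_sum)
    moreover have "exp (- ((s * norm y)\<^sup>2 / 2)) = (\<Prod>b\<in>Basis. exp (- ((s * (y \<bullet> b))\<^sup>2 / 2)))"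
      by (simp add: norm2 power_mult_distrib sum_distrib_left sum_divide_distrib sum_negf flip: exp_sum)
    ultimately show ?thesis
      by (simp add: prod.distrib)
  qed
  show "integrable lborel (\<lambda>y::'a. exp (\<i> * complex_of_real (y \<bullet> v)) * complex_of_real (exp (- ((s * norm y)\<^sup>2 / 2))))"
    unfolding eq by (intro integrable_lborel_prod gaussian_fourier_real s)
  have "(\<integral>y. exp (\<i> * complex_of_real (y \<bullet> v)) * complex_of_real (exp (- ((s * norm y)\<^sup>2 / 2))) \<partial>lborel)
      = (\<Prod>b\<in>Basis. complex_of_real (sqrt (2 * pi) / s * exp (- (((v \<bullet> b) / s)\<^sup>2 / 2))))"
    unfolding eq
    by (subst integral_lborel_prod) (simp_all only: gaussian_fourier_real[OF s])
  also have "\<dots> = complex_of_real ((sqrt (2 * pi) / s) ^ DIM('a) * (\<Prod>b\<in>Basis. exp (- (((v \<bullet> b) / s)\<^sup>2 / 2))))"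
    by (simp only: of_real_prod[symmetric] prod.distrib prod_constant)
  also have "(\<Prod>b\<in>Basis. exp (- (((v \<bullet> b) / s)\<^sup>2 / 2))) = exp (- ((norm v / s)\<^sup>2 / 2))"
    by (simp add: norm2 power_divide sum_divide_distrib sum_negf flip: exp_sum)
  finally show "(\<integral>y. exp (\<i> * complex_of_real (y \<bullet> v)) * complex_of_real (exp (- ((s * norm y)\<^sup>2 / 2))) \<partial>lborel)
      = complex_of_real ((sqrt (2 * pi) / s) ^ DIM('a) * exp (- ((norm v / s)\<^sup>2 / 2)))" .
qed

definition std_gaussian :: "'a::euclidean_space \<Rightarrow> real" where
  "std_gaussian v = (1 / sqrt (2 * pi)) ^ DIM('a) * exp (- ((norm v)\<^sup>2 / 2))"

lemma std_gaussian_nonneg [simp]: "0 \<le> std_gaussian v"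
  by (simp add: std_gaussian_def)

lemma borel_measurable_std_gaussian [measurable]: "std_gaussian \<in> borel_measurable borel"
  by (simp add: std_gaussian_def[abs_def])

lemma
  assumes "s > 0"
  shows integrable_gaussian: "integrable lborel (\<lambda>y::'a::euclidean_space. exp (- ((s * norm y)\<^sup>2 / 2)))"
    and integral_gaussian: "(\<integral>y. exp (- ((s * norm (y::'a))\<^sup>2 / 2)) \<partial>lborel) = (sqrt (2 * pi) / s) ^ DIM('a)"
proof -
  have "integrable lborel (\<lambda>y::'a. complex_of_real (exp (- ((s * norm y)\<^sup>2 / 2))))"
    using integrable_gaussian_fourier[OF assms, of "0::'a"] by simp
  from integrable_Re[OF this]
  show "integrable lborel (\<lambda>y::'a. exp (- ((s * norm y)\<^sup>2 / 2)))"
    by simp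
  have "complex_of_real (\<integral>y. exp (- ((s * norm (y::'a))\<^sup>2 / 2)) \<partial>lborel)
    = complex_of_real ((sqrt (2 * pi) / s) ^ DIM('a))"
    using gaussian_fourier[OF assms, of "0::'a"] by (simp flip: integral_complex_of_real)
  then show "(\<integral>y. exp (- ((s * norm (y::'a))\<^sup>2 / 2)) \<partial>lborel) = (sqrt (2 * pi) / s) ^ DIM('a)"
    unfolding of_real_eq_iff .
qed

lemma integrable_std_gaussian: "integrable lborel (std_gaussian :: 'a::euclidean_space \<Rightarrow> real)"
  and integral_std_gaussian: "(\<integral>v. std_gaussian (v::'a) \<partial>lborel) = 1"
proof -
  show "integrable lborel (std_gaussian :: 'a \<Rightarrow> real)"
    using integrable_gaussian[of 1, where 'a='a] by (simp add: std_gaussian_def[abs_def])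
  have "(\<integral>v. std_gaussian (v::'a) \<partial>lborel) = (1 / sqrt (2 * pi)) ^ DIM('a) * (sqrt (2 * pi)) ^ DIM('a)"
    using integral_gaussian[of 1, where 'a='a] by (simp add: std_gaussian_def[abs_def])
  then show "(\<integral>v. std_gaussian (v::'a) \<partial>lborel) = 1"
    by (simp flip: power_mult_distrib)
qed

lemma nn_integral_std_gaussian: "(\<integral>\<^sup>+v. std_gaussian (v::'a::euclidean_space) \<partial>lborel) = 1"
  by (subst nn_integral_eq_integral) (simp_all add: integrable_std_gaussian integral_std_gaussian)

section \<open>Continuity of translations in the mean\<close>

lemma nn_integral_lborel_translate:
  fixes f :: "'a::euclidean_space \<Rightarrow> ennreal"
  assumes [measurable]: "f \<in> borel_measurable borel"
  shows "(\<integral>\<^sup>+z. f (z + h) \<partial>lborel) = (\<integral>\<^sup>+z. f z \<partial>lborel)"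
  by (subst (2) lborel_distr_plus[of h, symmetric], subst nn_integral_distr) (simp_all add: add.commute)

text \<open>Three-term estimate: by translation invariance the two error terms are equal, and only
  the middle term depends on \<open>n\<close>. The property thus passes to L^1 limits, which is used
  for outer approximation of sets and for limits of integrable functions.\<close>

lemma translation_tendsto_L1_approx:
  fixes P :: "'a::euclidean_space \<Rightarrow> 'b::{banach,second_countable_topology}"
  assumes P [measurable]: "P \<in> borel_measurable borel"
    and Q: "\<And>e. e > 0 \<Longrightarrow> \<exists>Q \<in> borel_measurable borel. (\<integral>\<^sup>+z. norm (Q z - P z) \<partial>lborel) < ennreal e
      \<and> (\<lambda>n. \<integral>\<^sup>+z. norm (Q (z + h n) - Q z) \<partial>lborel) \<longlonglongrightarrow> 0"
  shows "(\<lambda>n. \<integral>\<^sup>+z. norm (P (z + h n) - P z) \<partial>lborel) \<longlonglongrightarrow> 0"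
proof (rule tendsto_zero_ennreal)
  fix r :: real assume "r > 0"
  then obtain Q where [measurable]: "Q \<in> borel_measurable borel"
    and QP: "(\<integral>\<^sup>+z. norm (Q z - P z) \<partial>lborel) < ennreal (r / 3)"
    and Q: "(\<lambda>n. \<integral>\<^sup>+z. norm (Q (z + h n) - Q z) \<partial>lborel) \<longlonglongrightarrow> 0"
    using Q[of "r / 3"] by auto
  have "\<forall>\<^sub>F n in sequentially. (\<integral>\<^sup>+z. norm (Q (z + h n) - Q z) \<partial>lborel) < ennreal (r / 3)"
    using \<open>r > 0\<close> by (intro order_tendstoD(2)[OF Q]) simp
  then show "\<forall>\<^sub>F n in sequentially. (\<integral>\<^sup>+z. norm (P (z + h n) - P z) \<partial>lborel) < ennreal r"
  proof eventually_elim
    case (elim n)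
    have *: "norm (P (z + h n) - P z)
        \<le> norm (Q (z + h n) - P (z + h n)) + norm (Q (z + h n) - Q z) + norm (Q z - P z)" for z
    proof -
      have "P (z + h n) - P z = (Q (z + h n) - Q z) + (Q z - P z) - (Q (z + h n) - P (z + h n))"
        by simp
      then show ?thesis
        by (smt (verit) norm_triangle_ineq norm_triangle_ineq4)
    qed
    have "(\<integral>\<^sup>+z. norm (P (z + h n) - P z) \<partial>lborel)
      \<le> (\<integral>\<^sup>+z. ennreal (norm (Q (z + h n) - P (z + h n))) + ennreal (norm (Q (z + h n) - Q z))
          + ennreal (norm (Q z - P z)) \<partial>lborel)"
      using * by (intro nn_integral_mono) (simp flip: ennreal_plus)
    also have "\<dots> = (\<integral>\<^sup>+z. norm (Q (z + h n) - P (z + h n)) \<partial>lborel)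
        + (\<integral>\<^sup>+z. norm (Q (z + h n) - Q z) \<partial>lborel) + (\<integral>\<^sup>+z. norm (Q z - P z) \<partial>lborel)"
      by (simp add: nn_integral_add)
    also have "(\<integral>\<^sup>+z. norm (Q (z + h n) - P (z + h n)) \<partial>lborel) = (\<integral>\<^sup>+z. norm (Q z - P z) \<partial>lborel)"
      by (rule nn_integral_lborel_translate[of "\<lambda>z. ennreal (norm (Q z - P z))"]) simp
    also have "(\<integral>\<^sup>+z. norm (Q z - P z) \<partial>lborel) + (\<integral>\<^sup>+z. norm (Q (z + h n) - Q z) \<partial>lborel)
        + (\<integral>\<^sup>+z. norm (Q z - P z) \<partial>lborel) < ennreal (r / 3) + ennreal (r / 3) + ennreal (r / 3)"
      by (intro add_strict_mono QP elim)
    also have "\<dots> = ennreal r"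
      using \<open>r > 0\<close> by (simp flip: ennreal_plus)
    finally show ?case .
  qed
qed

lemma translation_tendsto_L1_open:
  fixes U :: "'a::euclidean_space set"
  assumes U: "open U" "emeasure lborel U < \<infinity>" and h: "h \<longlonglongrightarrow> 0"
  shows "(\<lambda>n. \<integral>\<^sup>+z. norm (indicator U (z + h n) *\<^sub>R c - indicator U z *\<^sub>R c) \<partial>lborel) \<longlonglongrightarrow> 0"
proof -
  have [measurable]: "U \<in> sets borel"
    using U by simp
  \<comment> \<open>\<open>F n\<close> is the indicator of the intersection of \<open>U\<close> with
    a translate. The translated indicator itself may fail to converge on the boundary of
    \<open>U\<close>, which can have positive measure; the product vanishes off \<open>U\<close> and
    converges on \<open>U\<close> by openness.\<close>
  define F :: "nat \<Rightarrow> 'a \<Rightarrow> real"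
    where "F n z = indicator U z * indicator U (z + h n)" for n z
  have [measurable]: "F n \<in> borel_measurable borel" for n
    by (simp add: F_def[abs_def])
  have "(\<lambda>n. \<integral>\<^sup>+z. norm (F n z - indicator U z) \<partial>lborel) \<longlonglongrightarrow> 0"
  proof (rule Scheffe_lemma2)
    show "integrable lborel (indicator U :: 'a \<Rightarrow> real)"
      using U by simp
    show "AE z in lborel. (\<lambda>n. F n z) \<longlonglongrightarrow> (indicator U z :: real)"
    proof (rule AE_I2)
      fix z
      show "(\<lambda>n. F n z) \<longlonglongrightarrow> (indicator U z :: real)"
      proof (cases "z \<in> U")
        case True
        have "(\<lambda>n. z + h n) \<longlonglongrightarrow> z"
          using tendsto_add[OF tendsto_const h, of z] by simp
        from topological_tendstoD[OF this U(1) True]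
        have "\<forall>\<^sub>F n in sequentially. F n z = (indicator U z :: real)"
          by eventually_elim (simp add: F_def True)
        then show ?thesis
          by (rule tendsto_eventually)
      qed (simp add: F_def)
    qed
    show "(\<integral>\<^sup>+z. norm (F n z) \<partial>lborel) \<le> (\<integral>\<^sup>+z. norm (indicator U z :: real) \<partial>lborel)" for n
      by (intro nn_integral_mono) (simp add: F_def split: split_indicator)
  qed simp
  moreover have "(\<integral>\<^sup>+z. norm (indicator U (z + h n) *\<^sub>R c - indicator U z *\<^sub>R c) \<partial>lborel)
      = ennreal (2 * norm c) * (\<integral>\<^sup>+z. norm (F n z - indicator U z) \<partial>lborel)" for n
  proof -
    \<comment> \<open>The parts of the symmetric difference of \<open>U\<close> and its translate have equal measure.\<close>
    let ?I = "\<lambda>z. indicator U z :: ennreal"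
    let ?W = "\<integral>\<^sup>+z. ?I z * ?I (z + h n) \<partial>lborel"
    let ?D = "\<integral>\<^sup>+z. ?I z * indicator (- U) (z + h n) \<partial>lborel"
    let ?E = "\<integral>\<^sup>+z. ?I (z + h n) * indicator (- U) z \<partial>lborel"
    have "?W \<le> emeasure lborel U"
      by (subst nn_integral_indicator[symmetric], simp)
         (intro nn_integral_mono, simp split: split_indicator)
    \<comment> \<open>Finite measure of \<open>U\<close> makes \<open>?W\<close> finite, so that it
      can be cancelled from the two decompositions.\<close>
    with U have W: "?W \<noteq> \<infinity>"
      by auto
    have "?W + ?D = (\<integral>\<^sup>+z. ?I z \<partial>lborel)"
      by (subst nn_integral_add[symmetric]; (intro nn_integral_cong)?; simp split: split_indicator)
    also have "\<dots> = (\<integral>\<^sup>+z. ?I (z + h n) \<partial>lborel)"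
      by (subst nn_integral_lborel_translate) simp_all
    also have "\<dots> = ?W + ?E"
      by (subst nn_integral_add[symmetric]; (intro nn_integral_cong)?; simp split: split_indicator)
    finally have DE: "?D = ?E"
      using W by (simp add: ennreal_add_left_cancel)
    have "(\<integral>\<^sup>+z. norm (indicator U (z + h n) *\<^sub>R c - indicator U z *\<^sub>R c) \<partial>lborel)
      = (\<integral>\<^sup>+z. ennreal (norm c) * (?I z * indicator (- U) (z + h n) + ?I (z + h n) * indicator (- U) z) \<partial>lborel)"
      by (intro nn_integral_cong) (simp split: split_indicator)
    also have "\<dots> = ennreal (norm c) * (?D + ?D)"
      by (subst nn_integral_cmult) (simp_all add: nn_integral_add DE)
    also have "?D = (\<integral>\<^sup>+z. norm (F n z - indicator U z) \<partial>lborel)"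
      by (intro nn_integral_cong) (simp add: F_def split: split_indicator)
    finally show ?thesis
      by (simp add: ennreal_mult mult_ac flip: mult_2)
  qed
  ultimately show ?thesis
    using ennreal_tendsto_cmult[of "ennreal (2 * norm c)"] by fastforce
qed

text \<open>Induction over integrable functions. The indicator of a set is first replaced by that of
  an open superset of nearly the same measure, because openness is what gives pointwise
  convergence.\<close>

proposition translation_tendsto_L1:
  fixes P :: "'a::euclidean_space \<Rightarrow> 'b::{banach,second_countable_topology}"
  assumes "integrable lborel P" and h: "h \<longlonglongrightarrow> 0"
  shows "(\<lambda>n. \<integral>\<^sup>+z. norm (P (z + h n) - P z) \<partial>lborel) \<longlonglongrightarrow> 0"
  using assms(1)
proof (induction rule: integrable_induct)
  case (base A c)
  then have [measurable]: "A \<in> sets borel"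
    by simp
  show ?case
  proof (rule translation_tendsto_L1_approx)
    fix e :: real assume "e > 0"
    then have "e / (norm c + 1) > 0"
      by (intro divide_pos_pos) (simp_all add: add_nonneg_pos)
    then obtain U where U: "open U" "A \<subseteq> U" and UA: "emeasure lborel (U - A) < ennreal (e / (norm c + 1))"
      using outer_regular_lborel[of A "e / (norm c + 1)"] by auto
    have [measurable]: "U \<in> sets borel"
      using U by simp
    have "emeasure lborel U = emeasure lborel (A \<union> (U - A))"
      using U by (simp add: Un_absorb1)
    also have "\<dots> \<le> emeasure lborel A + emeasure lborel (U - A)"
      by (intro emeasure_subadditive) auto
    also have "\<dots> < \<infinity>"
      using base UA by (auto intro: less_trans)
    finally have "emeasure lborel U < \<infinity>" .
    moreover have "(\<integral>\<^sup>+z. norm (indicator U z *\<^sub>R c - indicator A z *\<^sub>R c) \<partial>lborel) < ennreal e"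
    proof -
      have "(\<integral>\<^sup>+z. norm (indicator U z *\<^sub>R c - indicator A z *\<^sub>R c) \<partial>lborel)
          = (\<integral>\<^sup>+z. ennreal (norm c) * indicator (U - A) z \<partial>lborel)"
        using U(2) by (intro nn_integral_cong) (auto split: split_indicator)
      also have "\<dots> = ennreal (norm c) * emeasure lborel (U - A)"
        by (simp add: nn_integral_cmult_indicator)
      also have "\<dots> \<le> ennreal (norm c) * ennreal (e / (norm c + 1))"
        using UA by (intro mult_left_mono) auto
      also have "\<dots> = ennreal (norm c * (e / (norm c + 1)))"
        using \<open>e > 0\<close> by (intro ennreal_mult[symmetric]) simp_all
      also have "\<dots> < ennreal e"
        using \<open>e > 0\<close> by (intro ennreal_lessI)
          (simp_all add: field_simps add_nonneg_pos add_pos_nonneg pos_divide_less_eq)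
      finally show ?thesis .
    qed
    ultimately show "\<exists>Q\<in>borel_measurable borel.
        (\<integral>\<^sup>+z. norm (Q z - indicator A z *\<^sub>R c) \<partial>lborel) < ennreal e
        \<and> (\<lambda>n. \<integral>\<^sup>+z. norm (Q (z + h n) - Q z) \<partial>lborel) \<longlonglongrightarrow> 0"
      using translation_tendsto_L1_open[OF U(1) _ h]
      by (intro bexI[of _ "\<lambda>z. indicator U z *\<^sub>R c"]) auto
  qed simp
next
  case (add f g)
  have [measurable]: "f \<in> borel_measurable borel" "g \<in> borel_measurable borel"
    using add by (auto dest: borel_measurable_integrable)
  have "(\<lambda>n. (\<integral>\<^sup>+z. norm (f (z + h n) - f z) \<partial>lborel) + (\<integral>\<^sup>+z. norm (g (z + h n) - g z) \<partial>lborel)) \<longlonglongrightarrow> 0 + 0"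
    by (intro tendsto_add add)
  then have lim: "(\<lambda>n. (\<integral>\<^sup>+z. norm (f (z + h n) - f z) \<partial>lborel) + (\<integral>\<^sup>+z. norm (g (z + h n) - g z) \<partial>lborel)) \<longlonglongrightarrow> 0"
    by simp
  show ?case
  proof (rule tendsto_sandwich[OF _ _ tendsto_const lim])
    have "norm (f (z + h n) + g (z + h n) - (f z + g z))
        \<le> norm (f (z + h n) - f z) + norm (g (z + h n) - g z)" for n z
      by (metis add_diff_add norm_triangle_ineq)
    then have "(\<integral>\<^sup>+z. norm (f (z + h n) + g (z + h n) - (f z + g z)) \<partial>lborel)
        \<le> (\<integral>\<^sup>+z. ennreal (norm (f (z + h n) - f z)) + ennreal (norm (g (z + h n) - g z)) \<partial>lborel)" for n
      by (intro nn_integral_mono) (simp flip: ennreal_plus)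
    then show "\<forall>\<^sub>F n in sequentially. (\<integral>\<^sup>+z. norm (f (z + h n) + g (z + h n) - (f z + g z)) \<partial>lborel)
      \<le> (\<integral>\<^sup>+z. norm (f (z + h n) - f z) \<partial>lborel) + (\<integral>\<^sup>+z. norm (g (z + h n) - g z) \<partial>lborel)"
      by (simp add: nn_integral_add)
  qed simp
next
  case (lim f s)
  have [measurable]: "f \<in> borel_measurable borel" "s i \<in> borel_measurable borel" for i
    using lim by (auto dest: borel_measurable_integrable)
  show ?case
  proof (rule translation_tendsto_L1_approx)
    fix e :: real assume "e > 0"
    have "(\<lambda>i. \<integral>\<^sup>+z. norm (f z - s i z) \<partial>lborel) \<longlonglongrightarrow> 0"
    proof (rule nn_integral_dominated_convergence_norm)
      have "integrable lborel (\<lambda>z. 2 * norm (f z))"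
        using lim by auto
      then show "(\<integral>\<^sup>+z. ennreal (2 * norm (f z)) \<partial>lborel) < \<infinity>"
        by (subst nn_integral_eq_integral) auto
    qed (use lim in auto)
    then have "\<forall>\<^sub>F i in sequentially. (\<integral>\<^sup>+z. norm (f z - s i z) \<partial>lborel) < ennreal e"
      using \<open>e > 0\<close> by (intro order_tendstoD(2)) auto
    then obtain i where "(\<integral>\<^sup>+z. norm (f z - s i z) \<partial>lborel) < ennreal e"
      using eventually_happens by fastforce
    then show "\<exists>Q\<in>borel_measurable borel. (\<integral>\<^sup>+z. norm (Q z - f z) \<partial>lborel) < ennreal e
        \<and> (\<lambda>n. \<integral>\<^sup>+z. norm (Q (z + h n) - Q z) \<partial>lborel) \<longlonglongrightarrow> 0"
      using lim.IH[of i] by (intro bexI[of _ "s i"]) (auto simp: norm_minus_commute)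
  qed simp
qed

section \<open>Gaussian averages\<close>

lemma lborel_integral_affine:
  fixes f :: "'a::euclidean_space \<Rightarrow> 'b::{banach,second_countable_topology}"
  assumes [measurable]: "f \<in> borel_measurable borel" and c: "c \<noteq> 0"
  shows "(\<integral>z. f z \<partial>lborel) = \<bar>c\<bar> ^ DIM('a) *\<^sub>R (\<integral>v. f (t + c *\<^sub>R v) \<partial>lborel)"
  by (subst lborel_affine[OF c, of t])
     (simp add: integral_density integral_distr)

text \<open>Supplies the integrability for the Fubini exchanges below, where \<open>k\<close> is the
  oscillating factor that couples the two variables.\<close>

lemma integrable_tensor:
  fixes f :: "'a::euclidean_space \<Rightarrow> complex" and g :: "'b::euclidean_space \<Rightarrow> complex"
  assumes f: "integrable lborel f" and g: "integrable lborel g"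
    and k [measurable]: "k \<in> borel_measurable (lborel \<Otimes>\<^sub>M lborel)" and "\<And>p. norm (k p) \<le> 1"
  shows "integrable (lborel \<Otimes>\<^sub>M lborel) (\<lambda>(x, y). k (x, y) * (f x * g y))"
proof -
  have [measurable]: "f \<in> borel_measurable borel" "g \<in> borel_measurable borel"
    using f g by (auto dest: borel_measurable_integrable)
  have "integrable (lborel \<Otimes>\<^sub>M lborel) (\<lambda>(x, y). f x * g y)"
    by (rule lborel_pair.Fubini_integrable) (use f g in \<open>auto simp: norm_mult\<close>)
  then show ?thesis
    by (rule Bochner_Integration.integrable_bound)
       (use assms(4) in \<open>auto simp: norm_mult mult_left_le_one_le\<close>)
qed

text \<open>The inverse transform without its normalising constant. On pairs (x, t) the inner
  product is the full space-time phase, so one notion serves the spatial variables and the variables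
  of integration alike.\<close>

definition osc_integral :: "('a::euclidean_space \<Rightarrow> complex) \<Rightarrow> 'a \<Rightarrow> complex" where
  "osc_integral P y = (\<integral>z. exp (\<i> * complex_of_real (y \<bullet> z)) * P z \<partial>lborel)"

lemma integrable_osc:
  fixes P :: "'a::euclidean_space \<Rightarrow> complex"
  assumes "integrable lborel P"
  shows "integrable lborel (\<lambda>z. exp (\<i> * complex_of_real (y \<bullet> z)) * P z)"
    and "integrable lborel (\<lambda>z. exp (- (\<i> * complex_of_real (z \<bullet> y))) * P z)"
proof -
  have [measurable]: "P \<in> borel_measurable borel"
    using assms by (auto dest: borel_measurable_integrable)
  have "norm (exp (- (\<i> * complex_of_real t))) = 1" for t
    using norm_exp_i_times[of "- t"] by simp
  then show "integrable lborel (\<lambda>z. exp (\<i> * complex_of_real (y \<bullet> z)) * P z)"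
    "integrable lborel (\<lambda>z. exp (- (\<i> * complex_of_real (z \<bullet> y))) * P z)"
    by (auto intro!: Bochner_Integration.integrable_bound[OF assms] simp: norm_mult)
qed

lemma borel_measurable_osc_integral [measurable]:
  assumes [measurable]: "P \<in> borel_measurable borel"
  shows "osc_integral P \<in> borel_measurable borel"
  unfolding osc_integral_def[abs_def] by measurable

lemma norm_osc_integral_le: "norm (osc_integral P y) \<le> (\<integral>z. norm (P z) \<partial>lborel)"
proof -
  have "norm (osc_integral P y) \<le> (\<integral>z. norm (exp (\<i> * complex_of_real (y \<bullet> z)) * P z) \<partial>lborel)"
    unfolding osc_integral_def by (rule integral_norm_bound)
  then show ?thesis
    by (simp add: norm_mult)
qed

lemma osc_integral_cong_AE:
  assumes "P \<in> borel_measurable borel" "Q \<in> borel_measurable borel" "AE z in lborel. P z = Q z"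
  shows "osc_integral P = osc_integral Q"
  unfolding osc_integral_def[abs_def] using assms
  by (intro ext integral_cong_AE) auto

lemma inverse_fourier_eq_osc_integral:
  "inverse_fourier F x = complex_of_real (1 / (2 * pi) ^ DIM('a)) * osc_integral F (x::'a::euclidean_space)"
  by (simp add: inverse_fourier_def osc_integral_def)

lemma integrable_gaussian_mult_osc_integral:
  fixes P :: "'a::euclidean_space \<Rightarrow> complex"
  assumes P: "integrable lborel P" and s: "s > 0"
  shows "integrable lborel (\<lambda>y. complex_of_real (exp (- ((s * norm y)\<^sup>2 / 2))) * osc_integral P y)"
proof (rule Bochner_Integration.integrable_bound)
  show "integrable lborel (\<lambda>y::'a. exp (- ((s * norm y)\<^sup>2 / 2)) * (\<integral>z. norm (P z) \<partial>lborel))"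
    using integrable_gaussian[OF s] by auto
  have [measurable]: "P \<in> borel_measurable borel"
    using P by (auto dest: borel_measurable_integrable)
  show "(\<lambda>y. complex_of_real (exp (- ((s * norm y)\<^sup>2 / 2))) * osc_integral P y) \<in> borel_measurable lborel"
    by simp
  show "AE y in lborel. norm (complex_of_real (exp (- ((s * norm y)\<^sup>2 / 2))) * osc_integral P y)
      \<le> norm (exp (- ((s * norm y)\<^sup>2 / 2)) * (\<integral>z. norm (P z) \<partial>lborel))"
    by (auto simp: norm_mult norm_osc_integral_le intro!: order.trans[OF _ abs_ge_self])
qed

text \<open>For \<open>s > 0\<close> this is the convolution of \<open>P\<close> with the normal
  density of standard deviation \<open>s\<close>. After rescaling, the weight is a fixed probability
  density and \<open>s\<close> enters only through a translation of \<open>P\<close>, as dominated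
  convergence wants it.\<close>

definition gaussian_mean :: "real \<Rightarrow> ('a::euclidean_space \<Rightarrow> complex) \<Rightarrow> 'a \<Rightarrow> complex" where
  "gaussian_mean s P w = (\<integral>v. complex_of_real (std_gaussian v) * P (w + s *\<^sub>R v) \<partial>lborel)"

text \<open>Fubini puts the transform of the Gaussian inside. Per dimension it contributes
  \<open>sqrt (2 * pi) / s\<close>, the substitution z = w + s v a factor \<open>s\<close>, and
  normalising the density another \<open>sqrt (2 * pi)\<close>: altogether
  \<open>2 * pi\<close>.\<close>

lemma integral_gaussian_osc_integral:
  fixes P :: "'a::euclidean_space \<Rightarrow> complex"
  assumes P: "integrable lborel P" and s: "s > 0"
  shows "(\<integral>y. exp (- (\<i> * complex_of_real (y \<bullet> w))) *
      (complex_of_real (exp (- ((s * norm y)\<^sup>2 / 2))) * osc_integral P y) \<partial>lborel)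
    = complex_of_real ((2 * pi) ^ DIM('a)) * gaussian_mean s P w"
proof -
  have [measurable]: "P \<in> borel_measurable borel"
    using P by (auto dest: borel_measurable_integrable)
  let ?g = "\<lambda>y::'a. complex_of_real (exp (- ((s * norm y)\<^sup>2 / 2)))"
  let ?e = "\<lambda>y z. exp (\<i> * complex_of_real (y \<bullet> (z - w)))"
  have g: "integrable lborel ?g"
    using integrable_gaussian[OF s] by (rule integrable_of_real)
  have e: "exp (- (\<i> * complex_of_real (y \<bullet> w))) * exp (\<i> * complex_of_real (y \<bullet> z)) = ?e y z" for y z
    by (simp add: inner_diff_right algebra_simps flip: exp_add)
  have "(\<integral>y. exp (- (\<i> * complex_of_real (y \<bullet> w))) * (?g y * osc_integral P y) \<partial>lborel)
      = (\<integral>y. (\<integral>z. ?e y z * (?g y * P z) \<partial>lborel) \<partial>lborel)"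
  proof (rule Bochner_Integration.integral_cong[OF refl])
    fix y
    have "(\<integral>z. ?e y z * (?g y * P z) \<partial>lborel)
      = (\<integral>z. (exp (- (\<i> * complex_of_real (y \<bullet> w))) * ?g y) * (exp (\<i> * complex_of_real (y \<bullet> z)) * P z) \<partial>lborel)"
      unfolding e[symmetric] by (simp add: ac_simps)
    also have "\<dots> = (exp (- (\<i> * complex_of_real (y \<bullet> w))) * ?g y) * osc_integral P y"
      unfolding osc_integral_def by (rule integral_mult_right_zero)
    finally show "exp (- (\<i> * complex_of_real (y \<bullet> w))) * (?g y * osc_integral P y)
        = (\<integral>z. ?e y z * (?g y * P z) \<partial>lborel)"
      by (simp add: ac_simps)
  qed
  also have "\<dots> = (\<integral>z. (\<integral>y. ?e y z * (?g y * P z) \<partial>lborel) \<partial>lborel)"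
    by (rule lborel_pair.Fubini_integral[symmetric])
       (use integrable_tensor[OF g P, of "\<lambda>(y, z). ?e y z"] in \<open>simp add: case_prod_unfold\<close>)
  also have "\<dots> = (\<integral>z. complex_of_real ((sqrt (2 * pi) / s) ^ DIM('a)) *
      (complex_of_real (exp (- ((norm (z - w) / s)\<^sup>2 / 2))) * P z) \<partial>lborel)"
  proof (rule Bochner_Integration.integral_cong[OF refl])
    fix z
    have "(\<integral>y. ?e y z * (?g y * P z) \<partial>lborel) = (\<integral>y. ?e y z * ?g y \<partial>lborel) * P z"
      by (simp flip: mult.assoc)
    also have "(\<integral>y. ?e y z * ?g y \<partial>lborel)
        = complex_of_real ((sqrt (2 * pi) / s) ^ DIM('a) * exp (- ((norm (z - w) / s)\<^sup>2 / 2)))"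
      by (rule gaussian_fourier[OF s])
    finally show "(\<integral>y. ?e y z * (?g y * P z) \<partial>lborel) = complex_of_real ((sqrt (2 * pi) / s) ^ DIM('a)) *
      (complex_of_real (exp (- ((norm (z - w) / s)\<^sup>2 / 2))) * P z)"
      by simp
  qed
  also have "\<dots> = complex_of_real ((sqrt (2 * pi) / s) ^ DIM('a)) *
     (\<integral>z. complex_of_real (exp (- ((norm (z - w) / s)\<^sup>2 / 2))) * P z \<partial>lborel)"
    by (rule integral_mult_right_zero)
  also have "(\<integral>z. complex_of_real (exp (- ((norm (z - w) / s)\<^sup>2 / 2))) * P z \<partial>lborel)
      = s ^ DIM('a) *\<^sub>R (\<integral>v. complex_of_real (exp (- ((norm v)\<^sup>2 / 2))) * P (w + s *\<^sub>R v) \<partial>lborel)"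
    using s by (subst lborel_integral_affine[where t = w and c = s]) simp_all
  also have "(\<integral>v. complex_of_real (exp (- ((norm v)\<^sup>2 / 2))) * P (w + s *\<^sub>R v) \<partial>lborel)
      = complex_of_real (sqrt (2 * pi) ^ DIM('a)) * gaussian_mean s P w"
    unfolding gaussian_mean_def
    by (subst integral_mult_right_zero[symmetric], intro Bochner_Integration.integral_cong)
       (simp_all add: std_gaussian_def power_divide)
  also have "complex_of_real ((sqrt (2 * pi) / s) ^ DIM('a)) *
      s ^ DIM('a) *\<^sub>R (complex_of_real (sqrt (2 * pi) ^ DIM('a)) * gaussian_mean s P w)
      = complex_of_real ((sqrt (2 * pi) / s * s * sqrt (2 * pi)) ^ DIM('a)) * gaussian_mean s P w"
    by (simp only: scaleR_conv_of_real power_mult_distrib of_real_mult of_real_power mult_ac)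
  also have "sqrt (2 * pi) / s * s * sqrt (2 * pi) = 2 * pi"
    using s by simp
  finally show ?thesis .
qed

text \<open>Integrating over \<open>w\<close> first, translation invariance removes the dependence
  on \<open>v\<close> and leaves the L^1 norm of \<open>P\<close> times the Gaussian mass 1.\<close>

lemma integrable_gaussian_mean_kernel:
  fixes P :: "'a::euclidean_space \<Rightarrow> complex"
  assumes P: "integrable lborel P"
  shows "integrable (lborel \<Otimes>\<^sub>M lborel) (\<lambda>(w, v). complex_of_real (std_gaussian v) * P (w + s *\<^sub>R v))"
proof (rule integrableI_bounded)
  have [measurable]: "P \<in> borel_measurable borel"
    using P by (auto dest: borel_measurable_integrable)
  show "(\<lambda>(w, v). complex_of_real (std_gaussian v) * P (w + s *\<^sub>R v)) \<in> borel_measurable (lborel \<Otimes>\<^sub>M lborel)"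
    by measurable
  have "(\<integral>\<^sup>+p. norm (case p of (w, v) \<Rightarrow> complex_of_real (std_gaussian v) * P (w + s *\<^sub>R v)) \<partial>(lborel \<Otimes>\<^sub>M lborel))
     = (\<integral>\<^sup>+v. (\<integral>\<^sup>+w. ennreal (std_gaussian v) * ennreal (norm (P (w + s *\<^sub>R v))) \<partial>lborel) \<partial>lborel)"
    by (subst lborel_pair.nn_integral_snd[symmetric])
       (simp_all add: case_prod_unfold norm_mult ennreal_mult)
  also have "\<dots> = (\<integral>\<^sup>+v. ennreal (std_gaussian v) * (\<integral>\<^sup>+w. ennreal (norm (P w)) \<partial>lborel) \<partial>(lborel::'a measure))"
    using nn_integral_lborel_translate[of "\<lambda>w. ennreal (norm (P w))"]
    by (intro nn_integral_cong) (simp add: nn_integral_cmult)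
  also have "\<dots> = (\<integral>\<^sup>+w. ennreal (norm (P w)) \<partial>lborel)"
    by (simp add: nn_integral_multc nn_integral_std_gaussian)
  also have "\<dots> < \<infinity>"
    using P by (simp add: integrable_iff_bounded)
  finally show "(\<integral>\<^sup>+p. norm (case p of (w, v) \<Rightarrow> complex_of_real (std_gaussian v) * P (w + s *\<^sub>R v))
      \<partial>(lborel \<Otimes>\<^sub>M lborel)) < \<infinity>" .
qed

lemma
  fixes P :: "'a::euclidean_space \<Rightarrow> complex"
  assumes P: "integrable lborel P"
  shows integrable_gaussian_mean: "integrable lborel (gaussian_mean s P)"
    and AE_integrable_gaussian_mean:
      "AE w in lborel. integrable lborel (\<lambda>v. complex_of_real (std_gaussian v) * P (w + s *\<^sub>R v))"
  using lborel_pair.AE_integrable_fst[OF integrable_gaussian_mean_kernel[OF P, of s]]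
    lborel_pair.integrable_fst[OF integrable_gaussian_mean_kernel[OF P, of s]]
  by (simp_all add: gaussian_mean_def[abs_def])

text \<open>As the Gaussian has mass 1, \<open>P w\<close> can be put under the average. The L^1
  distance is then at most the Gaussian average of \<open>D (s n *\<^sub>R v)\<close>, where each
  term tends to 0 and all are bounded by twice the L^1 norm of \<open>P\<close>.\<close>

lemma gaussian_mean_tendsto_L1:
  fixes P :: "'a::euclidean_space \<Rightarrow> complex"
  assumes P: "integrable lborel P" and s: "s \<longlonglongrightarrow> 0"
  shows "(\<lambda>n. \<integral>w. norm (gaussian_mean (s n) P w - P w) \<partial>lborel) \<longlonglongrightarrow> 0"
proof -
  have [measurable]: "P \<in> borel_measurable borel"
    using P by (auto dest: borel_measurable_integrable)
  define D where "D h = (\<integral>\<^sup>+w. norm (P (w + h) - P w) \<partial>lborel)" for h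
  have [measurable]: "D \<in> borel_measurable borel"
    unfolding D_def[abs_def] by measurable
  have D_le: "D h \<le> 2 * (\<integral>\<^sup>+w. norm (P w) \<partial>lborel)" for h
  proof -
    have "D h \<le> (\<integral>\<^sup>+w. ennreal (norm (P (w + h))) + ennreal (norm (P w)) \<partial>lborel)"
      unfolding D_def by (intro nn_integral_mono) (simp add: norm_triangle_ineq4 flip: ennreal_plus)
    also have "\<dots> = (\<integral>\<^sup>+w. norm (P (w + h)) \<partial>lborel) + (\<integral>\<^sup>+w. norm (P w) \<partial>lborel)"
      by (rule nn_integral_add) simp_all
    also have "(\<integral>\<^sup>+w. norm (P (w + h)) \<partial>lborel) = (\<integral>\<^sup>+w. norm (P w) \<partial>lborel)"
      by (rule nn_integral_lborel_translate[of "\<lambda>w. ennreal (norm (P w))"]) simp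
    finally show ?thesis
      by (simp add: mult_2)
  qed
  have le: "(\<integral>\<^sup>+w. norm (gaussian_mean (s n) P w - P w) \<partial>lborel)
      \<le> (\<integral>\<^sup>+v. ennreal (std_gaussian v) * D (s n *\<^sub>R v) \<partial>lborel)" for n
  proof -
    have "AE w in lborel. ennreal (norm (gaussian_mean (s n) P w - P w))
        \<le> (\<integral>\<^sup>+v. ennreal (std_gaussian v) * ennreal (norm (P (w + s n *\<^sub>R v) - P w)) \<partial>lborel)"
      using AE_integrable_gaussian_mean[OF P, of "s n"]
    proof eventually_elim
      case (elim w)
      have i: "integrable lborel (\<lambda>v::'a. complex_of_real (std_gaussian v) * P w)"
        using integrable_std_gaussian[where 'a = 'a] by auto
      have "(\<integral>v. complex_of_real (std_gaussian (v::'a)) * P w \<partial>lborel) = P w"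
        using integral_std_gaussian[where 'a = 'a]
        by simp
      then have "gaussian_mean (s n) P w - P w = (\<integral>v. complex_of_real (std_gaussian v) * P (w + s n *\<^sub>R v)
          - complex_of_real (std_gaussian v) * P w \<partial>lborel)"
        unfolding gaussian_mean_def by (subst Bochner_Integration.integral_diff[OF elim i]) simp
      also have "ennreal (norm \<dots>) \<le> (\<integral>\<^sup>+v. norm (complex_of_real (std_gaussian v) * P (w + s n *\<^sub>R v)
          - complex_of_real (std_gaussian v) * P w) \<partial>lborel)"
        by (rule integral_norm_bound_ennreal) (intro Bochner_Integration.integrable_diff elim i)
      also have "\<dots> = (\<integral>\<^sup>+v. ennreal (std_gaussian v) * ennreal (norm (P (w + s n *\<^sub>R v) - P w)) \<partial>lborel)"
        by (intro nn_integral_cong) (simp add: norm_mult flip: right_diff_distrib ennreal_mult)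
      finally show ?case .
    qed
    then have "(\<integral>\<^sup>+w. norm (gaussian_mean (s n) P w - P w) \<partial>lborel)
        \<le> (\<integral>\<^sup>+w. (\<integral>\<^sup>+v. ennreal (std_gaussian v) * ennreal (norm (P (w + s n *\<^sub>R v) - P w)) \<partial>lborel) \<partial>lborel)"
      by (rule nn_integral_mono_AE)
    also have "\<dots> = (\<integral>\<^sup>+v. (\<integral>\<^sup>+w. ennreal (std_gaussian v) * ennreal (norm (P (w + s n *\<^sub>R v) - P w)) \<partial>lborel) \<partial>lborel)"
      by (rule lborel_pair.Fubini'[symmetric]) measurable
    also have "\<dots> = (\<integral>\<^sup>+v. ennreal (std_gaussian v) * D (s n *\<^sub>R v) \<partial>lborel)"
      unfolding D_def by (intro nn_integral_cong nn_integral_cmult) simp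
    finally show ?thesis .
  qed
  have "(\<lambda>n. \<integral>\<^sup>+v. ennreal (std_gaussian v) * D (s n *\<^sub>R v) \<partial>lborel) \<longlonglongrightarrow> (\<integral>\<^sup>+v. 0 \<partial>(lborel::'a measure))"
  proof (rule nn_integral_dominated_convergence)
    show "AE v in lborel. ennreal (std_gaussian v) * D (s n *\<^sub>R v)
        \<le> ennreal (std_gaussian v) * (2 * (\<integral>\<^sup>+w. norm (P w) \<partial>lborel))" for n
      by (intro AE_I2 mult_left_mono D_le) simp
    have "(\<integral>\<^sup>+v. ennreal (std_gaussian v) * (2 * (\<integral>\<^sup>+w. norm (P w) \<partial>lborel)) \<partial>(lborel::'a measure))
        = 2 * (\<integral>\<^sup>+w. norm (P w) \<partial>lborel)"
      by (simp add: nn_integral_multc nn_integral_std_gaussian)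
    also have "\<dots> < \<infinity>"
      using P by (simp add: integrable_iff_bounded ennreal_mult_less_top)
    finally show "(\<integral>\<^sup>+v. ennreal (std_gaussian v) * (2 * (\<integral>\<^sup>+w. norm (P w) \<partial>lborel)) \<partial>(lborel::'a measure)) < \<infinity>" .
    show "AE v in lborel. (\<lambda>n. ennreal (std_gaussian (v::'a)) * D (s n *\<^sub>R v)) \<longlonglongrightarrow> 0"
    proof (rule AE_I2)
      fix v :: 'a
      have "(\<lambda>n. s n *\<^sub>R v) \<longlonglongrightarrow> 0"
        using tendsto_scaleR[OF s tendsto_const, of v] by simp
      from translation_tendsto_L1[OF P this]
      have "(\<lambda>n. D (s n *\<^sub>R v)) \<longlonglongrightarrow> 0"
        by (simp add: D_def)
      from ennreal_tendsto_cmult[OF _ this, of "ennreal (std_gaussian v)"]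
      show "(\<lambda>n. ennreal (std_gaussian (v::'a)) * D (s n *\<^sub>R v)) \<longlonglongrightarrow> 0"
        by simp
    qed
  qed simp_all
  then have lim: "(\<lambda>n. \<integral>\<^sup>+v. ennreal (std_gaussian v) * D (s n *\<^sub>R v) \<partial>lborel) \<longlonglongrightarrow> 0"
    by simp
  have "(\<lambda>n. \<integral>\<^sup>+w. norm (gaussian_mean (s n) P w - P w) \<partial>lborel) \<longlonglongrightarrow> 0"
    by (rule tendsto_sandwich[OF _ always_eventually tendsto_const lim]) (simp_all add: le)
  then have "(\<lambda>n. enn2real (\<integral>\<^sup>+w. norm (gaussian_mean (s n) P w - P w) \<partial>lborel)) \<longlonglongrightarrow> 0"
    by (intro tendsto_enn2real) simp_all
  then show ?thesis
    using P integrable_gaussian_mean[OF P]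
    by (simp add: integral_eq_nn_integral borel_measurable_integrable)
qed

text \<open>L^1 convergence gives pointwise convergence only along a subsequence. This suffices for
  inversion, where the full sequence has a known limit, and for Plancherel, where Fatou's lemma is
  applied.\<close>

lemma gaussian_mean_AE_subseq:
  fixes P :: "'a::euclidean_space \<Rightarrow> complex"
  assumes P: "integrable lborel P" and s: "s \<longlonglongrightarrow> 0"
  obtains r where "strict_mono r" "AE w in lborel. (\<lambda>n. gaussian_mean (s (r n)) P w) \<longlonglongrightarrow> P w"
proof -
  from tendsto_L1_AE_subseq[OF _ gaussian_mean_tendsto_L1[OF P s]] obtain r :: "nat \<Rightarrow> nat"
    where r: "strict_mono r" "AE w in lborel. (\<lambda>n. gaussian_mean (s (r n)) P w - P w) \<longlonglongrightarrow> 0"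
    using integrable_gaussian_mean[OF P] P by blast
  from r(2) have "AE w in lborel. (\<lambda>n. gaussian_mean (s (r n)) P w) \<longlonglongrightarrow> P w"
    by eventually_elim (rule LIM_zero_cancel)
  with r(1) show ?thesis
    by (rule that)
qed

section \<open>Fourier inversion and the Plancherel identity\<close>

lemma cnj_osc_integral:
  "cnj (osc_integral P y) = (\<integral>z. exp (- (\<i> * complex_of_real (y \<bullet> z))) * cnj (P z) \<partial>lborel)"
proof -
  have "cnj (osc_integral P y) = (\<integral>z. cnj (exp (\<i> * complex_of_real (y \<bullet> z)) * P z) \<partial>lborel)"
    unfolding osc_integral_def by (rule Bochner_Integration.integral_cnj[symmetric])
  then show ?thesis
    by (simp add: exp_cnj del: Bochner_Integration.integral_cnj)
qed

lemma gaussian_tendsto_1: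
  assumes "s \<longlonglongrightarrow> 0"
  shows "(\<lambda>n. exp (- ((s n * norm (y :: 'a::real_normed_vector))\<^sup>2 / 2))) \<longlonglongrightarrow> 1"
proof -
  have "(\<lambda>n. exp (- ((s n * norm y)\<^sup>2 / 2))) \<longlonglongrightarrow> exp (- ((0 * norm y)\<^sup>2 / 2))"
    by (intro tendsto_intros assms) simp
  then show ?thesis
    by simp
qed

lemma inverse_Suc_tendsto_0: "(\<lambda>n. 1 / real (Suc n)) \<longlonglongrightarrow> 0"
  using LIMSEQ_inverse_real_of_nat by (simp add: inverse_eq_divide)

text \<open>The damped integrals of \<open>G\<close> have two limits: the undamped integral, by
  dominated convergence since \<open>G\<close> is integrable, and, along a subsequence, a multiple
  of \<open>H\<close>, since they are multiples of Gaussian means of \<open>H\<close>.\<close>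

proposition fourier_inversion_AE:
  fixes G H :: "'a::euclidean_space \<Rightarrow> complex"
  assumes H: "integrable lborel H" and G: "integrable lborel G"
    and eq: "AE x in lborel. G x = osc_integral H x"
  shows "AE \<xi> in lborel. (\<integral>x. exp (- (\<i> * complex_of_real (x \<bullet> \<xi>))) * G x \<partial>lborel)
    = complex_of_real ((2 * pi) ^ DIM('a)) * H \<xi>"
proof -
  have [measurable]: "G \<in> borel_measurable borel" "H \<in> borel_measurable borel"
    using G H by (auto dest: borel_measurable_integrable)
  define s where "s n = 1 / real (Suc n)" for n
  have s: "s \<longlonglongrightarrow> 0" and s_pos: "s n > 0" for n
    using inverse_Suc_tendsto_0 by (simp_all add: s_def[abs_def] s_def)
  let ?g = "\<lambda>n y::'a. complex_of_real (exp (- ((s n * norm y)\<^sup>2 / 2)))"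
  let ?e = "\<lambda>\<xi> x. exp (- (\<i> * complex_of_real (x \<bullet> \<xi>)))"
  have lim: "(\<lambda>n. complex_of_real ((2 * pi) ^ DIM('a)) * gaussian_mean (s n) H \<xi>)
      \<longlonglongrightarrow> (\<integral>x. ?e \<xi> x * G x \<partial>lborel)" for \<xi>
  proof -
    have "(\<lambda>n. \<integral>x. ?e \<xi> x * (?g n x * G x) \<partial>lborel) \<longlonglongrightarrow> (\<integral>x. ?e \<xi> x * G x \<partial>lborel)"
    proof (rule integral_dominated_convergence)
      show "integrable lborel (\<lambda>x. norm (?e \<xi> x * G x))"
        using integrable_osc(2)[OF G] by (rule integrable_norm)
      show "AE x in lborel. (\<lambda>n. ?e \<xi> x * (?g n x * G x)) \<longlonglongrightarrow> ?e \<xi> x * G x"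
      proof (rule AE_I2)
        fix x
        have "(\<lambda>n. ?e \<xi> x * (?g n x * G x)) \<longlonglongrightarrow> ?e \<xi> x * (complex_of_real 1 * G x)"
          by (intro tendsto_intros gaussian_tendsto_1 s)
        then show "(\<lambda>n. ?e \<xi> x * (?g n x * G x)) \<longlonglongrightarrow> ?e \<xi> x * G x"
          by simp
      qed
      show "AE x in lborel. norm (?e \<xi> x * (?g n x * G x)) \<le> norm (?e \<xi> x * G x)" for n
        by (intro AE_I2) (auto simp: norm_mult intro!: mult_left_mono mult_left_le_one_le)
    qed simp_all
    moreover have "(\<integral>x. ?e \<xi> x * (?g n x * G x) \<partial>lborel)
        = complex_of_real ((2 * pi) ^ DIM('a)) * gaussian_mean (s n) H \<xi>" for n
      unfolding integral_gaussian_osc_integral[OF H s_pos, symmetric]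
      by (rule integral_cong_AE) (use eq in auto)
    ultimately show ?thesis
      by simp
  qed
  obtain r where r: "strict_mono r" "AE w in lborel. (\<lambda>n. gaussian_mean (s (r n)) H w) \<longlonglongrightarrow> H w"
    using gaussian_mean_AE_subseq[OF H s] .
  from r(2) show ?thesis
  proof eventually_elim
    case (elim \<xi>)
    show ?case
      using LIMSEQ_subseq_LIMSEQ[OF lim r(1), unfolded comp_def, of \<xi>] tendsto_mult[OF tendsto_const elim]
      by (rule LIMSEQ_unique)
  qed
qed

text \<open>Inversion for the difference of \<open>F\<close> and \<open>H\<close>, whose transform
  is almost everywhere the integrable function 0.\<close>

corollary osc_integral_inj_AE:
  fixes F H :: "'a::euclidean_space \<Rightarrow> complex"
  assumes F: "integrable lborel F" and H: "integrable lborel H"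
    and eq: "AE x in lborel. osc_integral F x = osc_integral H x"
  shows "AE \<xi> in lborel. F \<xi> = H \<xi>"
proof -
  have "osc_integral (\<lambda>\<xi>. F \<xi> - H \<xi>) x = osc_integral F x - osc_integral H x" for x
    unfolding osc_integral_def
    by (subst Bochner_Integration.integral_diff[symmetric])
       (simp_all add: integrable_osc F H right_diff_distrib)
  with eq have "AE x in lborel. 0 = osc_integral (\<lambda>\<xi>. F \<xi> - H \<xi>) x"
    by simp
  from fourier_inversion_AE[OF _ _ this] F H show ?thesis
    by simp
qed

text \<open>In the first branch of \<open>fourier\<close> this is inversion. In the second,
  \<open>H\<close> witnesses that the choice succeeds, and injectivity identifies the chosen
  function with \<open>H\<close>. Measurability is recorded because exchanging integrands through
  \<open>osc_integral_cong_AE\<close> requires it.\<close>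

proposition fourier_inverse_fourier:
  fixes G H :: "'a::euclidean_space \<Rightarrow> complex"
  assumes H: "integrable lborel H" and eq: "AE x in lborel. G x = inverse_fourier H x"
  shows "fourier G \<in> borel_measurable borel" and "AE \<xi> in lborel. fourier G \<xi> = H \<xi>"
proof -
  let ?c = "complex_of_real (1 / (2 * pi) ^ DIM('a))"
  have "fourier G \<in> borel_measurable borel \<and> (AE \<xi> in lborel. fourier G \<xi> = H \<xi>)"
  proof (cases "integrable lborel G")
    case True
    then have [measurable]: "G \<in> borel_measurable borel"
      by (auto dest: borel_measurable_integrable)
    have "osc_integral (\<lambda>\<xi>. ?c * H \<xi>) x = inverse_fourier H x" for x
      unfolding inverse_fourier_def osc_integral_def
      by (subst integral_mult_right_zero[symmetric]) (simp add: ac_simps)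
    with eq have "AE x in lborel. G x = osc_integral (\<lambda>\<xi>. ?c * H \<xi>) x"
      by simp
    from fourier_inversion_AE[OF _ True this] H
    have "AE \<xi> in lborel. fourier G \<xi> = H \<xi>"
      using True by (simp add: fourier_def)
    moreover have "fourier G \<in> borel_measurable borel"
      using True by (simp add: fourier_def)
    ultimately show ?thesis
      by blast
  next
    case False
    then have F: "integrable lborel (fourier G) \<and> (AE x in lborel. G x = inverse_fourier (fourier G) x)"
      using someI[of "\<lambda>F. integrable lborel F \<and> (AE x in lborel. G x = inverse_fourier F x)" H] H eq
      by (simp add: fourier_def)
    then have "AE x in lborel. osc_integral (fourier G) x = osc_integral H x"
      using eq by (auto simp: inverse_fourier_eq_osc_integral)
    from osc_integral_inj_AE[OF _ H this] F show ?thesis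
      by (auto dest: borel_measurable_integrable)
  qed
  then show "fourier G \<in> borel_measurable borel" and "AE \<xi> in lborel. fourier G \<xi> = H \<xi>"
    by auto
qed

lemma norm_integral_le_nn_integral:
  fixes f :: "_ \<Rightarrow> 'b::{banach,second_countable_topology}"
  shows "ennreal (norm (\<integral>x. f x \<partial>M)) \<le> (\<integral>\<^sup>+x. norm (f x) \<partial>M)"
  by (cases "integrable M f") (simp_all add: integral_norm_bound_ennreal not_integrable_integral_eq)

lemma nn_integral_le_tendsto:
  assumes [measurable]: "\<And>n. f n \<in> borel_measurable M"
    and lim: "AE x in M. (\<lambda>n. f n x :: ennreal) \<longlonglongrightarrow> g x"
    and le: "\<And>n::nat. (\<integral>\<^sup>+x. f n x \<partial>M) \<le> C"
  shows "(\<integral>\<^sup>+x. g x \<partial>M) \<le> C"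
proof -
  have "(\<integral>\<^sup>+x. g x \<partial>M) = (\<integral>\<^sup>+x. liminf (\<lambda>n. f n x) \<partial>M)"
    using lim by (intro nn_integral_cong_AE) (auto elim!: eventually_mono simp: lim_imp_Liminf)
  also have "\<dots> \<le> liminf (\<lambda>n. \<integral>\<^sup>+x. f n x \<partial>M)"
    by (rule nn_integral_liminf) simp
  also have "\<dots> \<le> limsup (\<lambda>n. \<integral>\<^sup>+x. f n x \<partial>M)"
    by (rule Liminf_le_Limsup) simp
  also have "\<dots> \<le> C"
    by (rule Limsup_bounded) (simp add: le)
  finally show ?thesis .
qed

text \<open>For each translate, a b \<le> (a^2 + b^2) / 2 bounds the correlation by half the sum of
  two integrals that translation invariance makes equal. The argument also covers an infinite
  right-hand side.\<close>

lemma nn_integral_gaussian_correlation_le: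
  fixes P :: "'a::euclidean_space \<Rightarrow> complex"
  assumes [measurable]: "P \<in> borel_measurable borel"
  shows "(\<integral>\<^sup>+w. ennreal (norm (P w)) *
      (\<integral>\<^sup>+v. ennreal (std_gaussian v) * ennreal (norm (P (w + s *\<^sub>R v))) \<partial>lborel) \<partial>lborel)
    \<le> (\<integral>\<^sup>+w. (norm (P w))\<^sup>2 \<partial>lborel)"
proof -
  let ?S = "\<integral>\<^sup>+w. (norm (P w))\<^sup>2 \<partial>lborel"
  have "(\<integral>\<^sup>+w. ennreal (norm (P w)) *
      (\<integral>\<^sup>+v. ennreal (std_gaussian v) * ennreal (norm (P (w + s *\<^sub>R v))) \<partial>lborel) \<partial>lborel)
    = (\<integral>\<^sup>+w. (\<integral>\<^sup>+v. ennreal (std_gaussian v) * (ennreal (norm (P w)) * ennreal (norm (P (w + s *\<^sub>R v)))) \<partial>lborel) \<partial>lborel)"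
    by (subst nn_integral_cmult[symmetric]) (simp_all add: mult_ac)
  also have "\<dots> = (\<integral>\<^sup>+v. (\<integral>\<^sup>+w. ennreal (std_gaussian v) * (ennreal (norm (P w)) * ennreal (norm (P (w + s *\<^sub>R v)))) \<partial>lborel) \<partial>lborel)"
    by (rule lborel_pair.Fubini'[symmetric]) measurable
  also have "\<dots> = (\<integral>\<^sup>+v. ennreal (std_gaussian v) * (\<integral>\<^sup>+w. ennreal (norm (P w)) * ennreal (norm (P (w + s *\<^sub>R v))) \<partial>lborel) \<partial>lborel)"
    by (simp add: nn_integral_cmult)
  also have "\<dots> \<le> (\<integral>\<^sup>+v. ennreal (std_gaussian v) * ?S \<partial>(lborel :: 'a measure))"
  proof (rule nn_integral_mono, rule mult_left_mono)
    fix v :: 'a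
    have *: "ennreal a * ennreal b \<le> ennreal (1/2) * ennreal (a\<^sup>2) + ennreal (1/2) * ennreal (b\<^sup>2)"
      if "a \<ge> 0" "b \<ge> 0" for a b :: real
    proof -
      have "ennreal a * ennreal b = ennreal (a * b)"
        using that by (simp add: ennreal_mult)
      also have "\<dots> \<le> ennreal (1/2 * a\<^sup>2 + 1/2 * b\<^sup>2)"
        using sum_squares_bound[of a b] by (intro ennreal_leI) simp
      also have "\<dots> = ennreal (1/2 * a\<^sup>2) + ennreal (1/2 * b\<^sup>2)"
        by (rule ennreal_plus) simp_all
      also have "\<dots> = ennreal (1/2) * ennreal (a\<^sup>2) + ennreal (1/2) * ennreal (b\<^sup>2)"
        by (subst (1 2) ennreal_mult) simp_all
      finally show ?thesis .
    qed
    have "(\<integral>\<^sup>+w. ennreal (norm (P w)) * ennreal (norm (P (w + s *\<^sub>R v))) \<partial>lborel)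
      \<le> (\<integral>\<^sup>+w. ennreal (1/2) * ennreal ((norm (P w))\<^sup>2) + ennreal (1/2) * ennreal ((norm (P (w + s *\<^sub>R v)))\<^sup>2) \<partial>lborel)"
      by (intro nn_integral_mono *) simp_all
    also have "\<dots> = ennreal (1/2) * ?S + ennreal (1/2) * (\<integral>\<^sup>+w. ennreal ((norm (P (w + s *\<^sub>R v)))\<^sup>2) \<partial>lborel)"
      by (simp add: nn_integral_add nn_integral_cmult)
    also have "(\<integral>\<^sup>+w. ennreal ((norm (P (w + s *\<^sub>R v)))\<^sup>2) \<partial>lborel) = ?S"
      by (rule nn_integral_lborel_translate[of "\<lambda>w. ennreal ((norm (P w))\<^sup>2)"]) simp
    also have "ennreal (1/2) * ?S + ennreal (1/2) * ?S = (ennreal (1/2) + ennreal (1/2)) * ?S"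
      by (simp only: distrib_right)
    also have "ennreal (1/2) + ennreal (1/2) = 1"
      using ennreal_plus[of "1/2" "1/2"] by simp
    finally show "(\<integral>\<^sup>+w. ennreal (norm (P w)) * ennreal (norm (P (w + s *\<^sub>R v))) \<partial>lborel) \<le> ?S"
      by simp
  qed simp
  also have "\<dots> = ?S"
    by (simp add: nn_integral_multc nn_integral_std_gaussian)
  finally show ?thesis .
qed

text \<open>Damping makes the squared transform integrable. Written as the damped transform times
  the conjugate transform, it becomes by Fubini a pairing of \<open>P\<close> with its Gaussian
  mean, which the correlation bound controls.\<close>

lemma gaussian_plancherel_le:
  fixes P :: "'a::euclidean_space \<Rightarrow> complex"
  assumes P: "integrable lborel P" and s: "s > 0"
  shows "(\<integral>\<^sup>+y. ennreal (exp (- ((s * norm y)\<^sup>2 / 2)) * (norm (osc_integral P y))\<^sup>2) \<partial>lborel)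
    \<le> ennreal ((2 * pi) ^ DIM('a)) * (\<integral>\<^sup>+w. (norm (P w))\<^sup>2 \<partial>lborel)"
proof -
  have [measurable]: "P \<in> borel_measurable borel"
    using P by (auto dest: borel_measurable_integrable)
  have cP: "integrable lborel (\<lambda>w. cnj (P w))"
    using P by simp
  let ?g = "\<lambda>y::'a. exp (- ((s * norm y)\<^sup>2 / 2))"
  let ?h = "\<lambda>y. complex_of_real (?g y) * osc_integral P y"
  let ?e = "\<lambda>y w. exp (- (\<i> * complex_of_real (y \<bullet> w)))"
  have h: "integrable lborel ?h"
    using integrable_gaussian_mult_osc_integral[OF P s] .
  have ne: "norm (?e y w) \<le> 1" for y w :: 'a
    using norm_exp_i_times[of "- (y \<bullet> w)"] by simp
  have sq: "?h y * cnj (osc_integral P y) = complex_of_real (?g y * (norm (osc_integral P y))\<^sup>2)" for y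
    by (simp only: complex_norm_square of_real_mult mult.assoc)
  have fubini: "(\<integral>y. ?h y * cnj (osc_integral P y) \<partial>lborel)
      = (\<integral>w. cnj (P w) * (complex_of_real ((2 * pi) ^ DIM('a)) * gaussian_mean s P w) \<partial>lborel)"
  proof -
    have "(\<integral>y. ?h y * cnj (osc_integral P y) \<partial>lborel)
        = (\<integral>y. (\<integral>w. ?e y w * (?h y * cnj (P w)) \<partial>lborel) \<partial>lborel)"
    proof (rule Bochner_Integration.integral_cong[OF refl])
      fix y
      have "?h y * cnj (osc_integral P y) = (\<integral>w. ?h y * (?e y w * cnj (P w)) \<partial>lborel)"
        unfolding cnj_osc_integral by (rule integral_mult_right_zero[symmetric])
      then show "?h y * cnj (osc_integral P y) = (\<integral>w. ?e y w * (?h y * cnj (P w)) \<partial>lborel)"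
        by (simp add: ac_simps)
    qed
    also have "\<dots> = (\<integral>w. (\<integral>y. ?e y w * (?h y * cnj (P w)) \<partial>lborel) \<partial>lborel)"
      by (rule lborel_pair.Fubini_integral[symmetric])
         (use integrable_tensor[OF h cP, of "\<lambda>(y, w). ?e y w"] ne in \<open>simp add: case_prod_unfold\<close>)
    also have "\<dots> = (\<integral>w. cnj (P w) * (\<integral>y. ?e y w * ?h y \<partial>lborel) \<partial>lborel)"
      by (subst integral_mult_right_zero[symmetric]) (simp add: ac_simps)
    also have "\<dots> = (\<integral>w. cnj (P w) * (complex_of_real ((2 * pi) ^ DIM('a)) * gaussian_mean s P w) \<partial>lborel)"
      by (simp only: integral_gaussian_osc_integral[OF P s])
    finally show ?thesis .
  qed
  have int: "integrable lborel (\<lambda>y. ?g y * (norm (osc_integral P y))\<^sup>2)"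
  proof (rule Bochner_Integration.integrable_bound)
    show "integrable lborel (\<lambda>y::'a. ?g y * (\<integral>z. norm (P z) \<partial>lborel)\<^sup>2)"
      using integrable_gaussian[OF s] by auto
    show "AE y in lborel. norm (?g y * (norm (osc_integral P y))\<^sup>2) \<le> norm (?g y * (\<integral>z. norm (P z) \<partial>lborel)\<^sup>2)"
      by (auto simp: norm_mult abs_mult intro!: power_mono norm_osc_integral_le)
  qed simp
  \<comment> \<open>The integral is a nonnegative real, hence equals the modulus of its complex
    value, to which \<open>fubini\<close> and the triangle inequality apply.\<close>
  have "(\<integral>\<^sup>+y. ennreal (?g y * (norm (osc_integral P y))\<^sup>2) \<partial>lborel)
      = ennreal (norm (complex_of_real (\<integral>y. ?g y * (norm (osc_integral P y))\<^sup>2 \<partial>lborel)))"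
    using int by (subst nn_integral_eq_integral) (auto simp: integral_nonneg_AE)
  also have "complex_of_real (\<integral>y. ?g y * (norm (osc_integral P y))\<^sup>2 \<partial>lborel)
      = (\<integral>w. cnj (P w) * (complex_of_real ((2 * pi) ^ DIM('a)) * gaussian_mean s P w) \<partial>lborel)"
    unfolding fubini[symmetric] sq by (rule integral_complex_of_real[symmetric])
  also have "ennreal (norm \<dots>) \<le> (\<integral>\<^sup>+w. norm (cnj (P w) * (complex_of_real ((2 * pi) ^ DIM('a)) * gaussian_mean s P w)) \<partial>lborel)"
    by (rule norm_integral_le_nn_integral)
  also have "\<dots> \<le> (\<integral>\<^sup>+w. ennreal ((2 * pi) ^ DIM('a)) * (ennreal (norm (P w)) *
      (\<integral>\<^sup>+v. ennreal (std_gaussian v) * ennreal (norm (P (w + s *\<^sub>R v))) \<partial>lborel)) \<partial>lborel)"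
  proof (rule nn_integral_mono_AE)
    show "AE w in lborel. ennreal (norm (cnj (P w) * (complex_of_real ((2 * pi) ^ DIM('a)) * gaussian_mean s P w)))
      \<le> ennreal ((2 * pi) ^ DIM('a)) * (ennreal (norm (P w)) *
      (\<integral>\<^sup>+v. ennreal (std_gaussian v) * ennreal (norm (P (w + s *\<^sub>R v))) \<partial>lborel))"
      using AE_integrable_gaussian_mean[OF P, of s]
    proof eventually_elim
      case (elim w)
      have "ennreal (norm (gaussian_mean s P w))
          \<le> (\<integral>\<^sup>+v. norm (complex_of_real (std_gaussian v) * P (w + s *\<^sub>R v)) \<partial>lborel)"
        unfolding gaussian_mean_def by (rule integral_norm_bound_ennreal[OF elim])
      also have "\<dots> = (\<integral>\<^sup>+v. ennreal (std_gaussian v) * ennreal (norm (P (w + s *\<^sub>R v))) \<partial>lborel)"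
        by (simp add: norm_mult ennreal_mult)
      finally have "ennreal ((2 * pi) ^ DIM('a)) * (ennreal (norm (P w)) * ennreal (norm (gaussian_mean s P w)))
          \<le> ennreal ((2 * pi) ^ DIM('a)) * (ennreal (norm (P w)) *
      (\<integral>\<^sup>+v. ennreal (std_gaussian v) * ennreal (norm (P (w + s *\<^sub>R v))) \<partial>lborel))"
        by (intro mult_left_mono) simp_all
      moreover have "norm (cnj (P w) * (complex_of_real ((2 * pi) ^ DIM('a)) * gaussian_mean s P w))
          = (2 * pi) ^ DIM('a) * (norm (P w) * norm (gaussian_mean s P w))"
        by (simp add: norm_mult norm_power mult_ac)
      ultimately show ?case
        by (simp add: ennreal_mult)
    qed
  qed
  also have "\<dots> \<le> ennreal ((2 * pi) ^ DIM('a)) * (\<integral>\<^sup>+w. (norm (P w))\<^sup>2 \<partial>lborel)"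
    by (subst nn_integral_cmult) (auto intro!: mult_left_mono nn_integral_gaussian_correlation_le)
  finally show ?thesis .
qed

lemma plancherel_le:
  fixes P :: "'a::euclidean_space \<Rightarrow> complex"
  assumes P: "integrable lborel P"
  shows "(\<integral>\<^sup>+y. ennreal ((norm (osc_integral P y))\<^sup>2) \<partial>lborel)
    \<le> ennreal ((2 * pi) ^ DIM('a)) * (\<integral>\<^sup>+w. (norm (P w))\<^sup>2 \<partial>lborel)"
proof (rule nn_integral_le_tendsto)
  have [measurable]: "P \<in> borel_measurable borel"
    using P by (auto dest: borel_measurable_integrable)
  let ?f = "\<lambda>n y. ennreal (exp (- ((1 / real (Suc n) * norm y)\<^sup>2 / 2)) * (norm (osc_integral P y))\<^sup>2)"
  show "?f n \<in> borel_measurable lborel" for n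
    by measurable
  show "AE y in lborel. (\<lambda>n. ?f n y) \<longlonglongrightarrow> ennreal ((norm (osc_integral P y))\<^sup>2)"
  proof (rule AE_I2)
    fix y
    have "(\<lambda>n. ?f n y) \<longlonglongrightarrow> ennreal (1 * (norm (osc_integral P y))\<^sup>2)"
      by (intro tendsto_ennrealI tendsto_mult gaussian_tendsto_1[OF inverse_Suc_tendsto_0] tendsto_const)
    then show "(\<lambda>n. ?f n y) \<longlonglongrightarrow> ennreal ((norm (osc_integral P y))\<^sup>2)"
      by simp
  qed
  show "(\<integral>\<^sup>+y. ?f n y \<partial>lborel) \<le> ennreal ((2 * pi) ^ DIM('a)) * (\<integral>\<^sup>+w. (norm (P w))\<^sup>2 \<partial>lborel)" for n
    by (rule gaussian_plancherel_le[OF P]) simp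
qed

text \<open>This is the upper bound for the conjugate of the damped transform \<open>Q\<close>: its
  own transform is the conjugate of a multiple of the Gaussian mean of \<open>P\<close>, and damping
  only decreases the modulus.\<close>

lemma gaussian_plancherel_ge:
  fixes P :: "'a::euclidean_space \<Rightarrow> complex"
  assumes P: "integrable lborel P" and s: "s > 0"
  shows "ennreal ((2 * pi) ^ DIM('a)) * (\<integral>\<^sup>+w. (norm (gaussian_mean s P w))\<^sup>2 \<partial>lborel)
    \<le> (\<integral>\<^sup>+y. ennreal ((norm (osc_integral P y))\<^sup>2) \<partial>lborel)"
proof -
  have [measurable]: "gaussian_mean s P \<in> borel_measurable borel"
    using integrable_gaussian_mean[OF P] by (auto dest: borel_measurable_integrable)
  let ?c = "(2 * pi) ^ DIM('a)"
  define Q where "Q y = complex_of_real (exp (- ((s * norm y)\<^sup>2 / 2))) * osc_integral P y" for y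
  have Q: "integrable lborel (\<lambda>y. cnj (Q y))"
    unfolding Q_def by (intro complex_integrable_cnj[THEN iffD2]) (rule integrable_gaussian_mult_osc_integral[OF P s])
  have osc_Q: "osc_integral (\<lambda>y. cnj (Q y)) w = cnj (complex_of_real ?c * gaussian_mean s P w)" for w
  proof -
    have "cnj (complex_of_real ?c * gaussian_mean s P w)
        = (\<integral>y. cnj (exp (- (\<i> * complex_of_real (y \<bullet> w))) * Q y) \<partial>lborel)"
      unfolding integral_gaussian_osc_integral[OF P s, symmetric] Q_def[symmetric]
      by (rule Bochner_Integration.integral_cnj[symmetric])
    then show ?thesis
      by (simp add: osc_integral_def exp_cnj inner_commute del: Bochner_Integration.integral_cnj)
  qed
  \<comment> \<open>The square of \<open>?c\<close> comes from the transform of \<open>Q\<close>;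
    one factor, positive and finite, is cancelled at the end.\<close>
  have "ennreal ?c * (ennreal ?c * (\<integral>\<^sup>+w. (norm (gaussian_mean s P w))\<^sup>2 \<partial>lborel))
      = ennreal (?c\<^sup>2) * (\<integral>\<^sup>+w. (norm (gaussian_mean s P w))\<^sup>2 \<partial>lborel)"
    by (simp add: power2_eq_square ennreal_mult mult.assoc)
  also have "\<dots> = (\<integral>\<^sup>+w. ennreal (?c\<^sup>2) * (norm (gaussian_mean s P w))\<^sup>2 \<partial>lborel)"
    by (rule nn_integral_cmult[symmetric]) simp
  also have "\<dots> = (\<integral>\<^sup>+w. ennreal ((norm (osc_integral (\<lambda>y. cnj (Q y)) w))\<^sup>2) \<partial>lborel)"
    unfolding osc_Q complex_mod_cnj by (simp add: norm_mult norm_power power_mult_distrib ennreal_mult)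
  also have "\<dots> \<le> ennreal ?c * (\<integral>\<^sup>+y. (norm (cnj (Q y)))\<^sup>2 \<partial>lborel)"
    by (rule plancherel_le[OF Q])
  also have "\<dots> \<le> ennreal ?c * (\<integral>\<^sup>+y. ennreal ((norm (osc_integral P y))\<^sup>2) \<partial>lborel)"
    by (intro mult_left_mono nn_integral_mono ennreal_leI power_mono)
       (auto simp: Q_def norm_mult intro!: mult_left_le_one_le)
  finally show ?thesis
    by (simp add: ennreal_mult_le_mult_iff)
qed

text \<open>The reverse inequality follows from the bound for Gaussian means by Fatou's lemma, along
  a subsequence on which these converge to \<open>P\<close>.\<close>

theorem plancherel:
  fixes P :: "'a::euclidean_space \<Rightarrow> complex"
  assumes P: "integrable lborel P"
  shows "(\<integral>\<^sup>+y. ennreal ((norm (osc_integral P y))\<^sup>2) \<partial>lborel)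
    = ennreal ((2 * pi) ^ DIM('a)) * (\<integral>\<^sup>+w. (norm (P w))\<^sup>2 \<partial>lborel)"
proof (rule antisym[OF plancherel_le[OF P]])
  have [measurable]: "P \<in> borel_measurable borel" "gaussian_mean s P \<in> borel_measurable borel" for s
    using P integrable_gaussian_mean[OF P] by (auto dest: borel_measurable_integrable)
  let ?c = "ennreal ((2 * pi) ^ DIM('a))"
  obtain r where r: "strict_mono r" "AE w in lborel. (\<lambda>n. gaussian_mean (1 / real (Suc (r n))) P w) \<longlonglongrightarrow> P w"
    using gaussian_mean_AE_subseq[OF P inverse_Suc_tendsto_0] .
  have "(\<integral>\<^sup>+w. ?c * (norm (P w))\<^sup>2 \<partial>lborel) \<le> (\<integral>\<^sup>+y. ennreal ((norm (osc_integral P y))\<^sup>2) \<partial>lborel)"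
  proof (rule nn_integral_le_tendsto)
    let ?f = "\<lambda>n w. ?c * ennreal ((norm (gaussian_mean (1 / real (Suc (r n))) P w))\<^sup>2)"
    show "AE w in lborel. (\<lambda>n. ?f n w) \<longlonglongrightarrow> ?c * ennreal ((norm (P w))\<^sup>2)"
      using r(2) by eventually_elim (intro ennreal_tendsto_cmult tendsto_ennrealI tendsto_intros, simp_all)
    show "(\<integral>\<^sup>+w. ?f n w \<partial>lborel) \<le> (\<integral>\<^sup>+y. ennreal ((norm (osc_integral P y))\<^sup>2) \<partial>lborel)" for n
      using gaussian_plancherel_ge[OF P, of "1 / real (Suc (r n))"] by (simp add: nn_integral_cmult)
  qed simp
  then show "?c * (\<integral>\<^sup>+w. (norm (P w))\<^sup>2 \<partial>lborel) \<le> (\<integral>\<^sup>+y. ennreal ((norm (osc_integral P y))\<^sup>2) \<partial>lborel)"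
    by (simp add: nn_integral_cmult)
qed

section \<open>Lebesgue measure on vectors of vectors\<close>

lemma prod_Basis_vec:
  fixes f :: "'a::euclidean_space ^ 'n \<Rightarrow> 'b::comm_monoid_mult"
  shows "(\<Prod>b\<in>Basis. f b) = (\<Prod>i\<in>UNIV. \<Prod>c\<in>Basis. f (axis i c))"
proof -
  have B: "(Basis :: ('a ^ 'n) set) = (\<lambda>(i, c). axis i c) ` (UNIV \<times> Basis)"
    by (auto simp: Basis_vec_def)
  have inj: "inj_on (\<lambda>(i, c). axis i c :: 'a ^ 'n) (UNIV \<times> Basis)"
    by (auto simp: inj_on_def axis_eq_axis)
  have "(\<Prod>b\<in>Basis. f b) = (\<Prod>(i, c)\<in>UNIV \<times> Basis. f (axis i c))"
    unfolding B prod.reindex[OF inj] by (simp add: comp_def case_prod_unfold)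
  then show ?thesis
    by (simp only: prod.cartesian_product)
qed

lemma mem_box_vec:
  fixes l u x :: "'a::euclidean_space ^ 'n"
  shows "x \<in> box l u \<longleftrightarrow> (\<forall>i. x $ i \<in> box (l $ i) (u $ i))"
  by (auto simp: box_def Basis_vec_def inner_axis)

lemma vec_lambda_eq_sum_axis: "(\<chi> i. g i) = (\<Sum>i\<in>UNIV. axis i (g i))"
  by (auto simp: vec_eq_iff axis_def if_distrib cong: if_cong)

lemma borel_measurable_axis [measurable]:
  "(axis i :: 'a::euclidean_space \<Rightarrow> 'a ^ 'n) \<in> borel_measurable borel"
proof -
  have "linear (axis i :: 'a::euclidean_space \<Rightarrow> 'a ^ 'n)"
    by (rule linearI) (auto simp: vec_eq_iff axis_def)
  then show ?thesis
    by (intro borel_measurable_continuous_onI linear_continuous_on linear_linear[THEN iffD2])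
qed

lemma borel_measurable_vec_lambda [measurable]:
  fixes f :: "'n::finite \<Rightarrow> 'b \<Rightarrow> 'a::euclidean_space"
  assumes [measurable]: "\<And>i. f i \<in> borel_measurable M"
  shows "(\<lambda>x. \<chi> i. f i x) \<in> borel_measurable M"
  unfolding vec_lambda_eq_sum_axis by measurable

lemma borel_measurable_vec_nth [measurable (raw)]:
  fixes f :: "'b \<Rightarrow> 'a::euclidean_space ^ 'n"
  assumes [measurable]: "f \<in> borel_measurable M"
  shows "(\<lambda>x. f x $ i) \<in> borel_measurable M"
proof -
  have "(\<lambda>y :: 'a ^ 'n. y $ i) \<in> borel_measurable borel"
    by (intro borel_measurable_continuous_onI continuous_intros)
  from measurable_compose[OF assms this] show ?thesis .
qed

text \<open>Boxes are products of boxes, and the values on boxes determine \<open>lborel\<close>.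
  This opens the way to integrating component by component.\<close>

lemma lborel_vec:
  "(lborel :: ('a::euclidean_space ^ 'n) measure) = distr (\<Pi>\<^sub>M i\<in>UNIV. lborel) borel (\<lambda>g. \<chi> i. g i)"
proof (rule lborel_eqI)
  fix l u :: "'a ^ 'n" assume le: "\<And>b. b \<in> Basis \<Longrightarrow> l \<bullet> b \<le> u \<bullet> b"
  interpret product_sigma_finite "\<lambda>_::'n. lborel :: 'a measure" ..
  have "l $ i \<bullet> c \<le> u $ i \<bullet> c" if "c \<in> Basis" for i c
    using le[of "axis i c"] that by (simp add: inner_axis axis_in_Basis_iff)
  then have box: "emeasure lborel (box (l $ i) (u $ i)) = ennreal (\<Prod>c\<in>Basis. (u $ i - l $ i) \<bullet> c)"
    and nn: "0 \<le> (\<Prod>c\<in>Basis. (u $ i - l $ i) \<bullet> c)" for i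
    by (auto simp: inner_diff_left intro!: prod_nonneg)
  have "(\<lambda>g. \<chi> i. g i) -` box l u \<inter> space (\<Pi>\<^sub>M i\<in>UNIV. lborel) = (\<Pi>\<^sub>E i\<in>UNIV. box (l $ i) (u $ i))"
    by (auto simp: mem_box_vec space_PiM PiE_def Pi_def)
  then have "emeasure (distr (\<Pi>\<^sub>M i\<in>UNIV. lborel) borel (\<lambda>g. \<chi> i. g i)) (box l u)
      = (\<Prod>i\<in>UNIV. emeasure lborel (box (l $ i) (u $ i)))"
    by (simp add: emeasure_distr emeasure_PiM)
  also have "\<dots> = ennreal (\<Prod>i\<in>UNIV. \<Prod>c\<in>Basis. (u $ i - l $ i) \<bullet> c)"
    using nn by (simp add: box prod_ennreal)
  also have "\<dots> = ennreal (\<Prod>b\<in>Basis. (u - l) \<bullet> b)"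
    by (simp add: prod_Basis_vec inner_axis)
  finally show "emeasure (distr (\<Pi>\<^sub>M i\<in>UNIV. lborel) borel (\<lambda>g. \<chi> i. g i)) (box l u) = (\<Prod>b\<in>Basis. (u - l) \<bullet> b)" .
qed simp

lemma
  fixes f :: "'n::finite \<Rightarrow> 'a::euclidean_space \<Rightarrow> 'b::{real_normed_field,banach,second_countable_topology}"
  assumes f: "\<And>i. integrable lborel (f i)"
  shows integrable_vec_prod: "integrable lborel (\<lambda>x. \<Prod>i\<in>UNIV. f i (x $ i))"
    and integral_vec_prod: "(\<integral>x. (\<Prod>i\<in>UNIV. f i (x $ i)) \<partial>lborel) = (\<Prod>i\<in>UNIV. \<integral>x. f i x \<partial>lborel)"
proof -
  interpret product_sigma_finite "\<lambda>_::'n. lborel :: 'a measure" ..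
  have [measurable]: "f i \<in> borel_measurable borel" for i
    using f[of i] by (auto dest: borel_measurable_integrable)
  show "integrable lborel (\<lambda>x. \<Prod>i\<in>UNIV. f i (x $ i))"
    by (subst lborel_vec, subst integrable_distr_eq)
       (simp_all add: product_integrable_prod f)
  show "(\<integral>x. (\<Prod>i\<in>UNIV. f i (x $ i)) \<partial>lborel) = (\<Prod>i\<in>UNIV. \<integral>x. f i x \<partial>lborel)"
    by (subst lborel_vec, subst integral_distr)
       (simp_all add: product_integral_prod f)
qed

text \<open>When coordinate \<open>m\<close> is integrated first, the added term is a constant
  translation, since \<open>x $ n\<close> is held fixed.\<close>

lemma nn_integral_lborel_shear:
  fixes g :: "real ^ 'n \<Rightarrow> ennreal"
  assumes [measurable]: "g \<in> borel_measurable borel" and "m \<noteq> n"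
  shows "(\<integral>\<^sup>+x. g (x + axis m (c * x $ n)) \<partial>lborel) = (\<integral>\<^sup>+x. g x \<partial>lborel)"
proof -
  interpret product_sigma_finite "\<lambda>_::'n. lborel :: real measure" ..
  have split: "(\<integral>\<^sup>+x. h x \<partial>lborel)
      = (\<integral>\<^sup>+x. (\<integral>\<^sup>+y. h (\<chi> i. (x(m := y)) i) \<partial>lborel) \<partial>(\<Pi>\<^sub>M i\<in>UNIV - {m}. lborel))"
    if [measurable]: "h \<in> borel_measurable borel" for h :: "real ^ 'n \<Rightarrow> ennreal"
  proof -
    have "(\<integral>\<^sup>+x. h x \<partial>lborel) = (\<integral>\<^sup>+x. h (\<chi> i. x i) \<partial>(\<Pi>\<^sub>M i\<in>insert m (UNIV - {m}). lborel))"
      by (subst lborel_vec, subst nn_integral_distr) (simp_all add: insert_absorb)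
    also have "\<dots> = (\<integral>\<^sup>+x. (\<integral>\<^sup>+y. h (\<chi> i. (x(m := y)) i) \<partial>lborel) \<partial>(\<Pi>\<^sub>M i\<in>UNIV - {m}. lborel))"
      by (rule product_nn_integral_insert) (simp_all add: insert_absorb)
    finally show ?thesis .
  qed
  have "(\<integral>\<^sup>+x. g (x + axis m (c * x $ n)) \<partial>lborel)
      = (\<integral>\<^sup>+x. (\<integral>\<^sup>+y. g ((\<chi> i. (x(m := y)) i) + axis m (c * x n)) \<partial>lborel) \<partial>(\<Pi>\<^sub>M i\<in>UNIV - {m}. lborel))"
    by (subst split) (use \<open>m \<noteq> n\<close> in simp_all)
  also have "\<dots> = (\<integral>\<^sup>+x. (\<integral>\<^sup>+y. g (\<chi> i. (x(m := c * x n + y)) i) \<partial>lborel) \<partial>(\<Pi>\<^sub>M i\<in>UNIV - {m}. lborel))"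
    by (intro nn_integral_cong arg_cong[where f = g]) (auto simp: vec_eq_iff axis_def)
  also have "\<dots> = (\<integral>\<^sup>+x. (\<integral>\<^sup>+y. g (\<chi> i. (x(m := y)) i) \<partial>lborel) \<partial>(\<Pi>\<^sub>M i\<in>UNIV - {m}. lborel))"
  proof (rule nn_integral_cong)
    fix x :: "'n \<Rightarrow> real"
    have [measurable]: "(\<lambda>y. (x(m := y)) i) \<in> borel_measurable borel" for i
      by (cases "i = m") simp_all
    show "(\<integral>\<^sup>+y. g (\<chi> i. (x(m := c * x n + y)) i) \<partial>lborel) = (\<integral>\<^sup>+y. g (\<chi> i. (x(m := y)) i) \<partial>lborel)"
      by (subst (2) lborel_distr_plus[of "c * x n", symmetric], subst nn_integral_distr) simp_all
  qed
  also have "\<dots> = (\<integral>\<^sup>+x. g x \<partial>lborel)"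
    by (simp add: split)
  finally show ?thesis .
qed

lemma nn_integral_lborel_permute:
  fixes g :: "real ^ 'n \<Rightarrow> ennreal"
  assumes [measurable]: "g \<in> borel_measurable borel" and p: "p permutes UNIV"
  shows "(\<integral>\<^sup>+x. g (\<chi> i. x $ p i) \<partial>lborel) = (\<integral>\<^sup>+x. g x \<partial>lborel)"
proof -
  have "(lborel :: (real ^ 'n) measure) = distr lborel borel (\<lambda>x. \<chi> i. x $ p i)"
  proof (rule lborel_eqI)
    fix l u :: "real ^ 'n" assume le: "\<And>b. b \<in> Basis \<Longrightarrow> l \<bullet> b \<le> u \<bullet> b"
    let ?q = "\<lambda>x :: real ^ 'n. \<chi> i. x $ inv p i"
    have le': "l $ i \<le> u $ i" for i
      using le[of "axis i 1"] by (simp add: inner_axis axis_in_Basis_iff)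
    have "(\<lambda>x. \<chi> i. x $ p i) -` box l u = box (?q l) (?q u)"
      using p by (auto simp: mem_box_vec) (metis permutes_inverses)+
    then have "emeasure (distr lborel borel (\<lambda>x. \<chi> i. x $ p i)) (box l u) = emeasure lborel (box (?q l) (?q u))"
      by (simp add: emeasure_distr)
    also have "\<dots> = ennreal (\<Prod>b\<in>Basis. (?q u - ?q l) \<bullet> b)"
      by (rule emeasure_lborel_box) (auto simp: Basis_vec_def inner_axis le')
    also have "(\<Prod>b\<in>Basis. (?q u - ?q l) \<bullet> b) = (\<Prod>i\<in>UNIV. u $ inv p i - l $ inv p i)"
      by (simp add: prod_Basis_vec inner_axis)
    also have "\<dots> = (\<Prod>i\<in>UNIV. u $ i - l $ i)"
      using prod.permute[OF permutes_inv[OF p], of "\<lambda>i. u $ i - l $ i"] by (simp add: comp_def)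
    also have "\<dots> = (\<Prod>b\<in>Basis. (u - l) \<bullet> b)"
      by (simp add: prod_Basis_vec inner_axis)
    finally show "emeasure (distr lborel borel (\<lambda>x. \<chi> i. x $ p i)) (box l u) = (\<Prod>b\<in>Basis. (u - l) \<bullet> b)" .
  qed simp
  then show ?thesis
    by (subst (2) \<open>lborel = _\<close>, subst nn_integral_distr) simp_all
qed

lemma borel_measurable_matrix_vector_mult [measurable]:
  fixes A :: "real ^ 'n ^ 'm"
  shows "(*v) A \<in> borel_measurable borel"
  by (intro borel_measurable_continuous_onI continuous_intros)

text \<open>The library has this change of variables only for well-ordered index types.\<close>

proposition nn_integral_lborel_matrix:
  fixes A :: "real ^ 'n ^ 'n"
  assumes "g \<in> borel_measurable borel" "det A \<noteq> 0"
  shows "ennreal \<bar>det A\<bar> * (\<integral>\<^sup>+x. g (A *v x) \<partial>lborel) = (\<integral>\<^sup>+x. g x \<partial>lborel)"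
  using assms
\<comment> \<open>Every matrix is a product of matrices with a zero row (excluded by the
  determinant), diagonal matrices, transpositions and shears; the formula is multiplicative.\<close>
proof (induction A arbitrary: g rule: induct_matrix_elementary)
  case (1 A B g)
  note [measurable] = "1.prems"(1)
  have "(\<integral>\<^sup>+x. g x \<partial>lborel) = ennreal \<bar>det A\<bar> * (\<integral>\<^sup>+x. g (A *v x) \<partial>lborel)"
    using "1.prems" by (intro "1.IH"(1)[symmetric]) (auto simp: det_mul)
  also have "(\<integral>\<^sup>+x. g (A *v x) \<partial>lborel) = ennreal \<bar>det B\<bar> * (\<integral>\<^sup>+x. g (A *v (B *v x)) \<partial>lborel)"
    using "1.prems" by (intro "1.IH"(2)[of "\<lambda>x. g (A *v x)", symmetric]) (auto simp: det_mul)
  finally show ?case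
    by (simp add: det_mul abs_mult ennreal_mult mult.assoc matrix_vector_mul_assoc)
next
  case (2 A i)
  then show ?case
    by (simp add: det_zero_row)
next
  case (3 A)
  note [measurable] = "3.prems"(1)
  \<comment> \<open>The diagonal entries as a function on the basis, the form in which
    \<open>lborel_affine_euclidean\<close> takes its scaling factors.\<close>
  define c :: "real ^ 'n \<Rightarrow> real" where "c b = (A *v b) \<bullet> b" for b
  have Ax: "(A *v x) $ i = A $ i $ i * x $ i" for x i
    using "3.hyps"
    by (simp add: matrix_vector_mult_def) (subst sum.remove[of _ i], simp_all)
  have cb: "c (axis i 1) = A $ i $ i" for i
    by (simp add: c_def inner_axis Ax)
  have det: "det A = (\<Prod>i\<in>UNIV. A $ i $ i)"
    by (rule det_diagonal) (use "3.hyps" in auto)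
  have c: "c b \<noteq> 0" if "b \<in> Basis" for b
    using that "3.prems"(2) by (auto simp: Basis_vec_def cb det)
  have "(\<Prod>b\<in>Basis. \<bar>c b\<bar>) = \<bar>det A\<bar>"
    by (simp add: prod_Basis_vec cb det abs_prod)
  moreover have "0 + (\<Sum>b\<in>Basis. (c b * (x \<bullet> b)) *\<^sub>R b) = A *v x" for x
  proof (rule euclidean_eqI)
    fix b :: "real ^ 'n" assume b: "b \<in> Basis"
    then obtain i where i: "b = axis i 1"
      by (auto simp: Basis_vec_def)
    have "(0 + (\<Sum>b\<in>Basis. (c b * (x \<bullet> b)) *\<^sub>R b)) \<bullet> b = c b * (x \<bullet> b)"
      using b by (simp add: inner_sum_left_Basis)
    also have "\<dots> = (A *v x) \<bullet> b"
      by (simp add: i cb inner_axis Ax)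
    finally show "(0 + (\<Sum>b\<in>Basis. (c b * (x \<bullet> b)) *\<^sub>R b)) \<bullet> b = (A *v x) \<bullet> b" .
  qed
  ultimately have "lborel = density (distr lborel borel (\<lambda>x. A *v x)) (\<lambda>_. ennreal \<bar>det A\<bar>)"
    using lborel_affine_euclidean[of c 0] c by simp
  then have "(\<integral>\<^sup>+x. g x \<partial>lborel) = (\<integral>\<^sup>+x. g x \<partial>density (distr lborel borel (\<lambda>x. A *v x)) (\<lambda>_. ennreal \<bar>det A\<bar>))"
    by simp
  then show ?case
    by (simp add: nn_integral_density nn_integral_distr nn_integral_cmult)
next
  case (4 m n)
  let ?p = "Transposition.transpose m n"
  let ?A = "\<chi> i j. mat 1 $ i $ ?p j :: real ^ 'n ^ 'n"
  have p: "?p permutes UNIV"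
    by (rule permutes_swap_id) simp_all
  have "(?A *v x) $ i = x $ ?p i" for x i
  proof -
    have "i = ?p j \<longleftrightarrow> j = ?p i" for j
      by (metis transpose_involutory)
    then have "(?A *v x) $ i = (\<Sum>j\<in>UNIV. if j = ?p i then x $ j else 0)"
      unfolding matrix_vector_mult_def vec_lambda_beta by (intro sum.cong) (auto simp: mat_def)
    then show ?thesis
      by simp
  qed
  then have "?A *v x = (\<chi> i. x $ ?p i)" for x
    by (simp add: vec_eq_iff)
  moreover have "\<bar>det ?A\<bar> = 1"
    by (simp add: det_permute_columns p sign_swap_id abs_mult)
  ultimately show ?case
    using "4.prems" p by (simp add: nn_integral_lborel_permute)
next
  case (5 m n c)
  let ?A = "\<chi> i j. if i = m \<and> j = n then c else of_bool (i = j) :: real ^ 'n ^ 'n"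
  have "(?A *v x) = x + axis m (c * x $ n)" for x
  proof (simp add: vec_eq_iff, intro allI)
    fix i
    have "(?A *v x) $ i = (\<Sum>j\<in>UNIV. (if j = i then x $ j else 0) + (if j = n then (if i = m then c * x $ j else 0) else 0))"
      unfolding matrix_vector_mult_def using "5.hyps" by (auto intro!: sum.cong)
    also have "\<dots> = x $ i + axis m (c * x $ n) $ i"
      by (simp add: sum.distrib axis_def)
    finally show "(?A *v x) $ i = x $ i + axis m (c * x $ n) $ i" .
  qed
  moreover have "det ?A = 1"
  proof -
    have "?A = (\<chi> k. if k = m then row m (mat 1) + c *s row n (mat 1) else row k (mat 1))"
      using "5.hyps" by (auto simp: vec_eq_iff row_def mat_def)
    then show ?thesis
      using det_row_operation[OF "5.hyps", of "mat 1" c] by (simp only: det_I)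
  qed
  ultimately show ?case
    using "5.hyps" "5.prems" by (simp add: nn_integral_lborel_shear)
qed

section \<open>Determinants\<close>

lemma borel_measurable_det [measurable (raw)]:
  fixes f :: "'b \<Rightarrow> real ^ 'n ^ 'n"
  assumes [measurable]: "f \<in> borel_measurable M"
  shows "(\<lambda>x. det (f x)) \<in> borel_measurable M"
  unfolding det_def by measurable

text \<open>The determinant is a polynomial \<open>p\<close> in \<open>s\<close>. It is not the zero
  polynomial: for \<open>s\<close> larger than a bound on the operator norm of \<open>A\<close> the
  matrix is injective.\<close>

lemma finite_det_add_scaled_mat_eq_0:
  fixes A :: "real ^ 'n ^ 'n"
  shows "finite {s. det (A + s *\<^sub>R mat 1) = 0}"
proof -
  define p :: "real poly" where "p = det (\<chi> i j. [:A $ i $ j, if i = j then 1 else 0:])"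
  have p: "poly p s = det (A + s *\<^sub>R mat 1)" for s
    unfolding p_def det_def
    by (auto simp: poly_sum poly_prod mat_def if_distrib intro!: sum.cong prod.cong cong: if_cong)
  obtain B where B: "\<And>x. norm (A *v x) \<le> norm x * B"
    using bounded_linear.bounded[OF matrix_vector_mul_bounded_linear, of A] by blast
  let ?s = "\<bar>B\<bar> + 1"
  have "x = 0" if "(A + ?s *\<^sub>R mat 1) *v x = 0" for x
  proof (rule ccontr)
    assume "x \<noteq> 0"
    have "(A + ?s *\<^sub>R mat 1) *v x = A *v x + ?s *\<^sub>R x"
      by (simp add: matrix_vector_mult_add_rdistrib flip: scaleR_matrix_vector_assoc)
    with that have "A *v x = - (?s *\<^sub>R x)"
      by (simp add: eq_neg_iff_add_eq_0)
    then have "?s * norm x = norm (A *v x)"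
      by simp
    also have "\<dots> \<le> norm x * B"
      by (rule B)
    finally have "norm x * ?s \<le> norm x * B"
      by (simp add: mult.commute)
    then show False
      using \<open>x \<noteq> 0\<close> by (simp add: mult_le_cancel_left)
  qed
  then have "det (A + ?s *\<^sub>R mat 1) \<noteq> 0"
    unfolding invertible_det_nz[symmetric] invertible_left_inverse matrix_left_invertible_ker by blast
  then have "p \<noteq> 0"
    using p[of ?s] by auto
  then show ?thesis
    using poly_roots_finite[of p] by (simp add: p)
qed

text \<open>Fubini along the lines A + s I: each meets the zero set in finitely many points, while
  by translation invariance the measure of the zero set is the average over \<open>s\<close> in
  [0, 1] of the measures of its translates.\<close>

lemma AE_det_nonzero: "AE A in lborel. det (A :: real ^ 'n ^ 'n) \<noteq> 0"
proof -
  let ?Z = "\<lambda>A :: real ^ 'n ^ 'n. indicator {0} (det A) :: ennreal"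
  have [measurable]: "?Z \<in> borel_measurable borel"
    by measurable
  have "(\<integral>\<^sup>+A. ?Z A \<partial>lborel) = (\<integral>\<^sup>+s. indicator {0..1} s * (\<integral>\<^sup>+A. ?Z A \<partial>lborel) \<partial>(lborel :: real measure))"
    by (simp add: nn_integral_multc)
  also have "\<dots> = (\<integral>\<^sup>+s. (\<integral>\<^sup>+A. indicator {0..1} s * ?Z (A + s *\<^sub>R mat 1) \<partial>lborel) \<partial>(lborel :: real measure))"
  proof (rule nn_integral_cong)
    fix s :: real
    have "(\<integral>\<^sup>+A. ?Z (A + s *\<^sub>R mat 1) \<partial>lborel) = (\<integral>\<^sup>+A. ?Z A \<partial>lborel)"
      by (subst (2) lborel_distr_plus[of "s *\<^sub>R mat 1", symmetric], subst nn_integral_distr)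
         (simp_all add: add.commute)
    then show "indicator {0..1} s * (\<integral>\<^sup>+A. ?Z A \<partial>lborel)
        = (\<integral>\<^sup>+A. indicator {0..1} s * ?Z (A + s *\<^sub>R mat 1) \<partial>lborel)"
      by (subst nn_integral_cmult) simp_all
  qed
  also have "\<dots> = (\<integral>\<^sup>+A. (\<integral>\<^sup>+s. indicator {0..1} s * ?Z (A + s *\<^sub>R mat 1) \<partial>(lborel :: real measure)) \<partial>lborel)"
    by (rule lborel_pair.Fubini') measurable
  also have "\<dots> = (\<integral>\<^sup>+A. 0 \<partial>(lborel :: (real ^ 'n ^ 'n) measure))"
  proof (rule nn_integral_cong)
    fix A :: "real ^ 'n ^ 'n"
    have "AE s in lborel. s \<notin> {s. det (A + s *\<^sub>R mat 1) = 0}"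
      by (intro AE_not_in finite_imp_null_set_lborel finite_det_add_scaled_mat_eq_0)
    then have "AE s in lborel. indicator {0..1} s * ?Z (A + s *\<^sub>R mat 1) = 0"
      by eventually_elim simp
    then show "(\<integral>\<^sup>+s. indicator {0..1} s * ?Z (A + s *\<^sub>R mat 1) \<partial>(lborel :: real measure)) = 0"
      by (subst nn_integral_0_iff_AE) simp_all
  qed
  also have "\<dots> = 0"
    by simp
  finally have "AE A in lborel. ?Z A = 0"
    by (subst (asm) nn_integral_0_iff_AE) simp_all
  then show ?thesis
    by eventually_elim (auto simp: indicator_eq_0_iff)
qed

lemma prod_UNIV_option: "(\<Prod>j\<in>UNIV. f j) = f None * (\<Prod>i\<in>UNIV. f (Some i))" for f :: "'n::finite option \<Rightarrow> _"
  by (simp add: UNIV_option_conv prod.reindex)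

lemma sum_UNIV_option: "(\<Sum>j\<in>UNIV. f j) = f None + (\<Sum>i\<in>UNIV. f (Some i))" for f :: "'n::finite option \<Rightarrow> _"
  by (simp add: UNIV_option_conv sum.reindex)

text \<open>In the Leibniz sum a permutation moving \<open>None\<close> picks up a zero entry of the
  row \<open>None\<close>. The others are the images of the permutations of \<open>'n\<close> under
  \<open>map_permutation\<close>, which preserves signs.\<close>

lemma det_option_block:
  fixes M :: "'a::comm_ring_1 ^ 'n::finite option ^ 'n option"
  assumes M: "\<And>i. M $ None $ Some i = 0"
  shows "det M = M $ None $ None * det (\<chi> i j. M $ Some i $ Some j)"
proof -
  let ?t = "\<lambda>p. of_int (sign p) * (\<Prod>i\<in>UNIV. M $ i $ p i)"
  let ?P = "{p. p permutes (UNIV :: 'n option set)}"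
  let ?m = "map_permutation (UNIV :: 'n set) Some"
  have "det M = (\<Sum>p\<in>?P. ?t p)"
    by (simp add: det_def)
  also have "\<dots> = (\<Sum>p\<in>{p. p permutes range Some}. ?t p)"
  proof (rule sum.mono_neutral_right)
    show "{p. p permutes range (Some :: 'n \<Rightarrow> _)} \<subseteq> ?P"
      using permutes_subset[OF _ subset_UNIV] by blast
    show "\<forall>p\<in>?P - {p. p permutes range Some}. ?t p = 0"
    proof
      fix p :: "'n option \<Rightarrow> 'n option" assume p: "p \<in> ?P - {p. p permutes range Some}"
      have "p None \<noteq> None"
      proof
        assume "p None = None"
        then have "p x = x" if "x \<in> UNIV - range Some" for x
          using that by (cases x) auto
        with p show False
          using permutes_superset[of p UNIV "range Some"] by blast
      qed
      then obtain i where "p None = Some i"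
        by auto
      then show "?t p = 0"
        by (simp add: prod_UNIV_option M)
    qed
  qed (simp add: finite_permutations)
  also have "\<dots> = (\<Sum>q\<in>{q. q permutes UNIV}. M $ None $ None * (of_int (sign q) * (\<Prod>i\<in>UNIV. M $ Some i $ Some (q i))))"
  proof (rule sum.reindex_bij_witness[of _ ?m "\<lambda>p i. the (p (Some i))"])
    fix p :: "'n option \<Rightarrow> 'n option" assume "p \<in> {p. p permutes range Some}"
    then have p: "p permutes range Some"
      by simp
    let ?q = "\<lambda>i. the (p (Some i))"
    have None: "p None = None"
      using p by (auto simp: permutes_def)
    have Some: "Some (?q i) = p (Some i)" for i
      using permutes_in_image[OF p, of "Some i"] by auto
    have q: "?q permutes UNIV"
    proof (rule bij_imp_permutes)
      have "inj ?q"
        by (rule injI) (metis Some option.inject permutes_inj[OF p] injD)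
      then show "bij_betw ?q UNIV UNIV"
        by (simp add: finite_UNIV_inj_surj bij_def)
    qed simp
    then show "?q \<in> {q. q permutes UNIV}"
      by simp
    show m: "?m ?q = p"
    proof
      fix x show "?m ?q x = p x"
      proof (cases x)
        case None
        then show ?thesis
          using map_permutation_permutes[OF _ q, of Some "range Some"] \<open>p None = None\<close>
          by (auto simp: inj_on_imp_bij_betw permutes_def)
      next
        case (Some i)
        then show ?thesis
          using \<open>Some (?q i) = p (Some i)\<close> by (simp add: map_permutation_apply)
      qed
    qed
    have "sign p = sign ?q"
      using sign_map_permutation[OF _ q, of Some] by (simp add: m)
    then show "M $ None $ None * (of_int (sign ?q) * (\<Prod>i\<in>UNIV. M $ Some i $ Some (?q i))) = ?t p"
      by (simp add: prod_UNIV_option None Some mult_ac)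
  next
    fix q :: "'n \<Rightarrow> 'n" assume "q \<in> {q. q permutes UNIV}"
    then have q: "q permutes UNIV"
      by simp
    show "?m q \<in> {p. p permutes range Some}"
      using map_permutation_permutes[OF _ q, of Some "range Some"] by (simp add: inj_on_imp_bij_betw)
    show "(\<lambda>i. the (?m q (Some i))) = q"
      by (simp add: map_permutation_apply)
  qed
  also have "\<dots> = M $ None $ None * det (\<chi> i j. M $ Some i $ Some j)"
    by (simp add: det_def sum_distrib_left)
  finally show ?thesis .
qed

text \<open>Coordinates adapted to translation: one vertex and the edge vectors issuing from it. On
  the zero-sum subspace the spatial phase depends only on the edges, and so does
  \<open>rho\<close>.\<close>

definition translate_simplex :: "'a::euclidean_space \<Rightarrow> 'a ^ 'n \<Rightarrow> 'a ^ 'n option" where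
  "translate_simplex a v = (\<chi> j. case j of None \<Rightarrow> a | Some i \<Rightarrow> v $ i + a)"

lemma translate_simplex_nth [simp]:
  "translate_simplex a v $ None = a" "translate_simplex a v $ Some i = v $ i + a"
  by (simp_all add: translate_simplex_def)

text \<open>Column reduction as a factorisation: right multiplication by the unipotent
  \<open>B\<close> adds column \<open>None\<close> of \<open>M\<close> to every other column, which
  turns the row (1, 0, ..., 0) of \<open>M\<close> into the row of ones.\<close>

lemma rho_translate_simplex:
  fixes v :: "real ^ 'n ^ 'n"
  shows "rho (translate_simplex a v) = det v"
proof -
  define M :: "real ^ 'n option ^ 'n option"
    where "M = (\<chi> r c. case r of None \<Rightarrow> if c = None then 1 else 0
      | Some k \<Rightarrow> (case c of None \<Rightarrow> a $ k | Some i \<Rightarrow> v $ i $ k))"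
  define B :: "real ^ 'n option ^ 'n option"
    where "B = (\<chi> r c. if r = None \<or> r = c then 1 else 0)"
  have "(\<chi> r j. case r of None \<Rightarrow> 1 | Some k \<Rightarrow> translate_simplex a v $ j $ k) = M ** B"
    by (auto simp: vec_eq_iff matrix_matrix_mult_def M_def B_def sum_UNIV_option translate_simplex_def
        if_distrib split: option.split cong: if_cong)
  moreover have "det M = det v"
  proof -
    have "det M = det (\<chi> i j. M $ Some i $ Some j)"
      by (subst det_option_block) (simp_all add: M_def)
    also have "(\<chi> i j. M $ Some i $ Some j) = transpose v"
      by (simp add: M_def transpose_def vec_eq_iff)
    finally show ?thesis
      by (simp add: det_transpose)
  qed
  moreover have "det B = 1"
  proof -
    have "det B = det (transpose B)"
      by (simp add: det_transpose)
    also have "\<dots> = det (\<chi> i j. transpose B $ Some i $ Some j)"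
      by (subst det_option_block) (simp_all add: B_def transpose_def)
    also have "(\<chi> i j. transpose B $ Some i $ Some j) = mat 1"
      by (simp add: B_def transpose_def mat_def vec_eq_iff)
    finally show ?thesis
      by simp
  qed
  ultimately show ?thesis
    by (simp add: rho_def det_mul)
qed

section \<open>The change of variables\<close>

lemma borel_measurable_translate_simplex [measurable (raw)]:
  fixes f :: "'b \<Rightarrow> 'a::euclidean_space" and g :: "'b \<Rightarrow> 'a ^ 'n"
  assumes [measurable]: "f \<in> borel_measurable M" "g \<in> borel_measurable M"
  shows "(\<lambda>x. translate_simplex (f x) (g x)) \<in> borel_measurable M"
  unfolding translate_simplex_def
proof (rule borel_measurable_vec_lambda)
  fix j :: "'n option"
  show "(\<lambda>x. case j of None \<Rightarrow> f x | Some i \<Rightarrow> g x $ i + f x) \<in> borel_measurable M"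
    by (cases j) simp_all
qed

lemma translate_simplex_eq_iff: "translate_simplex a v = translate_simplex b v \<longleftrightarrow> a = b"
  by (metis translate_simplex_nth(1))

text \<open>The edges are the outer variable because, once they are fixed, the time frequencies are
  affine in \<open>a\<close>.\<close>

lemma nn_integral_translate_simplex:
  fixes g :: "'a::euclidean_space ^ 'n::finite option \<Rightarrow> ennreal"
  assumes [measurable]: "g \<in> borel_measurable borel"
  shows "(\<integral>\<^sup>+\<xi>. g \<xi> \<partial>lborel) = (\<integral>\<^sup>+v. (\<integral>\<^sup>+a. g (translate_simplex a v) \<partial>lborel) \<partial>lborel)"
proof -
  \<comment> \<open>Subtracting \<open>a\<close> makes \<open>S\<close> a mere regrouping of the
    vertices, so preimages of boxes are boxes; the passage to edge vectors is a translation done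
    afterwards for fixed \<open>a\<close>.\<close>
  define S :: "'a \<times> ('a ^ 'n) \<Rightarrow> 'a ^ 'n option" where
    "S = (\<lambda>(a, v). translate_simplex a (v - (\<chi> i. a)))"
  have S_nth: "S (a, v) $ None = a" "S (a, v) $ Some i = v $ i" for a v i
    by (simp_all add: S_def)
  have [measurable]: "S \<in> borel \<Otimes>\<^sub>M borel \<rightarrow>\<^sub>M borel"
    unfolding S_def by measurable
  have "(lborel :: ('a ^ 'n option) measure) = distr (lborel \<Otimes>\<^sub>M lborel) borel S"
  proof (rule lborel_eqI)
    fix l u :: "'a ^ 'n option" assume le: "\<And>b. b \<in> Basis \<Longrightarrow> l \<bullet> b \<le> u \<bullet> b"
    have le': "l $ j \<bullet> c \<le> u $ j \<bullet> c" if "c \<in> Basis" for j c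
      using le[of "axis j c"] that by (simp add: inner_axis axis_in_Basis_iff)
    let ?l = "(\<chi> i. l $ Some i) :: 'a ^ 'n" and ?u = "(\<chi> i. u $ Some i) :: 'a ^ 'n"
    have "S (a, v) \<in> box l u \<longleftrightarrow> a \<in> box (l $ None) (u $ None) \<and> v \<in> box ?l ?u" for a v
      unfolding mem_box_vec by (simp add: S_nth split_option_all)
    then have "S -` box l u \<inter> space (lborel \<Otimes>\<^sub>M lborel) = box (l $ None) (u $ None) \<times> box ?l ?u"
      by (auto simp: space_pair_measure)
    then have "emeasure (distr (lborel \<Otimes>\<^sub>M lborel) borel S) (box l u)
        = emeasure lborel (box (l $ None) (u $ None)) * emeasure lborel (box ?l ?u)"
      by (simp add: emeasure_distr lborel.emeasure_pair_measure_Times)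
    also have "\<dots> = ennreal (\<Prod>c\<in>Basis. (u $ None - l $ None) \<bullet> c) * ennreal (\<Prod>b\<in>Basis. (?u - ?l) \<bullet> b)"
      by (subst (1 2) emeasure_lborel_box) (auto simp: Basis_vec_def inner_axis le')
    also have "\<dots> = ennreal ((\<Prod>c\<in>Basis. (u $ None - l $ None) \<bullet> c) * (\<Prod>b\<in>Basis. (?u - ?l) \<bullet> b))"
      by (rule ennreal_mult[symmetric])
         (auto simp: Basis_vec_def inner_axis inner_diff_left le' intro!: prod_nonneg)
    also have "(\<Prod>c\<in>Basis. (u $ None - l $ None) \<bullet> c) * (\<Prod>b\<in>Basis. (?u - ?l) \<bullet> b) = (\<Prod>b\<in>Basis. (u - l) \<bullet> b)"
      by (simp add: prod_Basis_vec inner_axis prod_UNIV_option)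
    finally show "emeasure (distr (lborel \<Otimes>\<^sub>M lborel) borel S) (box l u) = (\<Prod>b\<in>Basis. (u - l) \<bullet> b)" .
  qed simp
  then have "(\<integral>\<^sup>+\<xi>. g \<xi> \<partial>lborel) = (\<integral>\<^sup>+\<xi>. g \<xi> \<partial>distr (lborel \<Otimes>\<^sub>M lborel) borel S)"
    by simp
  also have "\<dots> = (\<integral>\<^sup>+a. (\<integral>\<^sup>+v. g (S (a, v)) \<partial>lborel) \<partial>lborel)"
    by (subst nn_integral_distr) (simp_all add: lborel.nn_integral_fst[symmetric])
  also have "\<dots> = (\<integral>\<^sup>+a. (\<integral>\<^sup>+v. g (translate_simplex a v) \<partial>lborel) \<partial>lborel)"
  proof (rule nn_integral_cong)
    fix a :: 'a
    show "(\<integral>\<^sup>+v. g (S (a, v)) \<partial>lborel) = (\<integral>\<^sup>+v. g (translate_simplex a v) \<partial>lborel)"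
      by (subst lborel_distr_plus[of "\<chi> i. a", symmetric], subst nn_integral_distr) (simp_all add: S_def)
  qed
  also have "\<dots> = (\<integral>\<^sup>+v. (\<integral>\<^sup>+a. g (translate_simplex a v) \<partial>lborel) \<partial>lborel)"
    by (rule lborel_pair.Fubini') measurable
  finally show ?thesis .
qed

text \<open>Inverse of \<xi> -> (v, \<tau>): the base vertex a solves v_i . a = (\<tau>_i - |v_i|^2)
  / 2 for all i. Cramer's rule makes the map total and explicitly measurable; where det v = 0,
  division by zero gives the base vertex 0.\<close>

definition phase_inverse :: "(real ^ 'n ^ 'n) \<times> (real ^ 'n) \<Rightarrow> (real ^ 'n) ^ 'n::finite option" where
  "phase_inverse = (\<lambda>(v, \<tau>). translate_simplex
     (\<chi> k. det (\<chi> i j. if j = k then (\<tau> $ i - (norm (v $ i))\<^sup>2) / 2 else v $ i $ j) / det v) v)"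

lemma borel_measurable_phase_inverse [measurable]: "phase_inverse \<in> borel_measurable borel"
proof -
  have "phase_inverse \<in> borel \<Otimes>\<^sub>M borel \<rightarrow>\<^sub>M borel"
    unfolding phase_inverse_def case_prod_unfold
    by (intro borel_measurable_translate_simplex borel_measurable_vec_lambda
        borel_measurable_divide borel_measurable_det) measurable
  then show ?thesis
    by (simp add: borel_prod)
qed

lemma rho_phase_inverse: "rho (phase_inverse p) = det (fst p)"
  by (simp add: phase_inverse_def case_prod_unfold rho_translate_simplex)

lemma phase_inverse_eq_iff:
  assumes "det v \<noteq> 0"
  shows "phase_inverse (v, \<tau>) = translate_simplex a v \<longleftrightarrow> (\<forall>i. \<tau> $ i = (norm (v $ i))\<^sup>2 + 2 * (v $ i \<bullet> a))"
proof -
  have "phase_inverse (v, \<tau>) = translate_simplex a v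
      \<longleftrightarrow> a = (\<chi> k. det (\<chi> i j. if j = k then (\<chi> i. (\<tau> $ i - (norm (v $ i))\<^sup>2) / 2) $ i else v $ i $ j) / det v)"
    unfolding phase_inverse_def by (auto simp: translate_simplex_eq_iff cong: if_cong)
  also have "\<dots> \<longleftrightarrow> v *v a = (\<chi> i. (\<tau> $ i - (norm (v $ i))\<^sup>2) / 2)"
    by (rule cramer[OF assms, symmetric])
  also have "\<dots> \<longleftrightarrow> (\<forall>i. \<tau> $ i = (norm (v $ i))\<^sup>2 + 2 * (v $ i \<bullet> a))"
    by (auto simp: vec_eq_iff matrix_vector_mul_component field_simps)
  finally show ?thesis .
qed

lemma zero_sum_inner: "zero_sum x \<bullet> \<xi> = (\<Sum>i\<in>UNIV. x $ i \<bullet> (\<xi> $ Some i - \<xi> $ None))"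
  for x :: "'a::euclidean_space ^ 'n"
  by (simp add: inner_vec_def sum_UNIV_option zero_sum_def inner_diff_right sum_subtractf inner_sum_left)

lemma phase_eq:
  fixes x v :: "real ^ 'n ^ 'n" and t \<tau> :: "real ^ 'n"
  assumes "det v \<noteq> 0"
  defines "\<xi> \<equiv> phase_inverse (v, \<tau>)"
  shows "zero_sum x \<bullet> \<xi> + (\<Sum>j\<in>UNIV. zero_sum t $ j * (norm (\<xi> $ j))\<^sup>2) = (x, t) \<bullet> (v, \<tau>)"
proof -
  obtain a where \<xi>: "\<xi> = translate_simplex a v"
    unfolding \<xi>_def phase_inverse_def by auto
  with phase_inverse_eq_iff[OF assms(1), of \<tau> a]
  have \<tau>: "\<tau> $ i = (norm (v $ i))\<^sup>2 + 2 * (v $ i \<bullet> a)" for i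
    by (simp add: \<xi>_def)
  have "zero_sum x \<bullet> \<xi> = x \<bullet> v"
    unfolding zero_sum_inner by (simp add: \<xi> inner_vec_def)
  moreover have "(\<Sum>j\<in>UNIV. zero_sum t $ j * (norm (\<xi> $ j))\<^sup>2) = t \<bullet> \<tau>"
  proof -
    \<comment> \<open>The squared norms are read as a vector of reals, so that
      \<open>zero_sum_inner\<close> serves the time variables too.\<close>
    have "(\<Sum>j\<in>UNIV. zero_sum t $ j * (norm (\<xi> $ j))\<^sup>2) = zero_sum t \<bullet> (\<chi> j. (norm (\<xi> $ j))\<^sup>2)"
      by (simp add: inner_vec_def)
    also have "\<dots> = (\<Sum>i\<in>UNIV. t $ i * ((norm (v $ i + a))\<^sup>2 - (norm a)\<^sup>2))"
      unfolding zero_sum_inner by (simp add: \<xi>)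
    also have "\<dots> = (\<Sum>i\<in>UNIV. t $ i * \<tau> $ i)"
      unfolding \<tau> power2_norm_eq_inner by (simp add: inner_add_left inner_add_right inner_commute add.commute)
    finally show ?thesis
      by (simp add: inner_vec_def)
  qed
  ultimately show ?thesis
    by simp
qed

text \<open>For fixed \<open>v\<close> the map from \<open>a\<close> to \<tau> is
  \<open>2 *\<^sub>R v\<close> followed by a translation; its determinant 2^d det v cancels the
  weight. Edges with det v = 0 form a null set.\<close>

lemma nn_integral_phase_inverse:
  fixes g :: "(real ^ 'n) ^ 'n::finite option \<Rightarrow> ennreal"
  assumes [measurable]: "g \<in> borel_measurable borel"
  shows "(\<integral>\<^sup>+\<xi>. g \<xi> \<partial>lborel)
    = (\<integral>\<^sup>+p. ennreal (1 / (2 ^ CARD('n) * \<bar>det (fst p)\<bar>)) * g (phase_inverse p) \<partial>lborel)"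
proof -
  let ?w = "\<lambda>v :: real ^ 'n ^ 'n. ennreal (1 / (2 ^ CARD('n) * \<bar>det v\<bar>))"
  have [measurable]: "phase_inverse \<in> borel \<Otimes>\<^sub>M borel \<rightarrow>\<^sub>M (borel :: ((real ^ 'n) ^ 'n option) measure)"
    using borel_measurable_phase_inverse by (simp add: borel_prod)
  have "(\<integral>\<^sup>+p. ?w (fst p) * g (phase_inverse p) \<partial>lborel)
      = (\<integral>\<^sup>+v. (\<integral>\<^sup>+\<tau>. ?w v * g (phase_inverse (v, \<tau>)) \<partial>lborel) \<partial>lborel)"
    unfolding lborel_prod[symmetric] by (subst lborel.nn_integral_fst[symmetric]) simp_all
  also have "\<dots> = (\<integral>\<^sup>+v. (\<integral>\<^sup>+a. g (translate_simplex a v) \<partial>lborel) \<partial>lborel)"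
  proof (rule nn_integral_cong_AE)
    show "AE v in lborel. (\<integral>\<^sup>+\<tau>. ?w v * g (phase_inverse (v, \<tau>)) \<partial>lborel)
        = (\<integral>\<^sup>+a. g (translate_simplex a v) \<partial>lborel)"
      using AE_det_nonzero
    proof eventually_elim
      case (elim v)
      let ?b = "\<chi> i. (norm (v $ i))\<^sup>2"
      have det: "det (2 *\<^sub>R v) = 2 ^ CARD('n) * det v"
      proof -
        have "2 *\<^sub>R v = (\<chi> i. 2 *s v $ i)"
          by (simp add: vec_eq_iff)
        then show ?thesis
          using det_rows_mul[of "\<lambda>_. 2" "\<lambda>i. v $ i"] by simp
      qed
      have inverse: "phase_inverse (v, ?b + (2 *\<^sub>R v) *v a) = translate_simplex a v" for a
        by (subst phase_inverse_eq_iff[OF elim])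
           (simp add: matrix_vector_mul_component)
      have "(\<integral>\<^sup>+\<tau>. g (phase_inverse (v, \<tau>)) \<partial>lborel) = (\<integral>\<^sup>+\<tau>. g (phase_inverse (v, ?b + \<tau>)) \<partial>lborel)"
        by (subst lborel_distr_plus[of ?b, symmetric], subst nn_integral_distr) simp_all
      also have "\<dots> = ennreal \<bar>det (2 *\<^sub>R v)\<bar> * (\<integral>\<^sup>+a. g (phase_inverse (v, ?b + (2 *\<^sub>R v) *v a)) \<partial>lborel)"
        using elim by (subst nn_integral_lborel_matrix) (simp_all add: det)
      also have "\<dots> = ennreal \<bar>det (2 *\<^sub>R v)\<bar> * (\<integral>\<^sup>+a. g (translate_simplex a v) \<partial>lborel)"
        by (simp only: inverse)
      finally have "(\<integral>\<^sup>+\<tau>. ?w v * g (phase_inverse (v, \<tau>)) \<partial>lborel)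
          = ?w v * (ennreal \<bar>det (2 *\<^sub>R v)\<bar> * (\<integral>\<^sup>+a. g (translate_simplex a v) \<partial>lborel))"
        by (subst nn_integral_cmult) simp_all
      also have "\<dots> = ennreal (1 / (2 ^ CARD('n) * \<bar>det v\<bar>) * \<bar>det (2 *\<^sub>R v)\<bar>) * (\<integral>\<^sup>+a. g (translate_simplex a v) \<partial>lborel)"
        by (subst ennreal_mult) (simp_all add: mult.assoc)
      also have "1 / (2 ^ CARD('n) * \<bar>det v\<bar>) * \<bar>det (2 *\<^sub>R v)\<bar> = 1"
        using elim by (simp add: det abs_mult)
      finally show ?case
        by simp
    qed
  qed
  finally show ?thesis
    by (simp add: nn_integral_translate_simplex)
qed

text \<open>As an equality of measures, the change of variables also applies to Bochner integrals of
  complex functions.\<close>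

lemma lborel_phase_inverse:
  "(lborel :: ((real ^ 'n) ^ 'n::finite option) measure)
    = distr (density lborel (\<lambda>p. ennreal (1 / (2 ^ CARD('n) * \<bar>det (fst p)\<bar>)))) borel phase_inverse"
proof (rule measure_eqI)
  have [measurable]: "(\<lambda>p :: (real ^ 'n ^ 'n) \<times> (real ^ 'n). fst p) \<in> borel_measurable borel"
    by (intro borel_measurable_continuous_onI continuous_intros)
  fix A :: "((real ^ 'n) ^ 'n option) set" assume "A \<in> sets lborel"
  then have [measurable]: "A \<in> sets borel"
    by simp
  have [measurable]: "phase_inverse -` A \<in> sets borel"
    by (rule measurable_sets_borel[OF borel_measurable_phase_inverse]) simp
  show "emeasure lborel A = emeasure (distr (density lborel
      (\<lambda>p. ennreal (1 / (2 ^ CARD('n) * \<bar>det (fst p)\<bar>)))) borel phase_inverse) A"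
    using nn_integral_phase_inverse[of "indicator A"]
    by (simp add: emeasure_distr emeasure_density indicator_vimage[symmetric] comp_def)
qed simp

lemma borel_measurable_rho [measurable]:
  "(rho :: (real ^ 'n::finite) ^ 'n option \<Rightarrow> real) \<in> borel_measurable borel"
  unfolding rho_def[abs_def]
proof (intro borel_measurable_det borel_measurable_vec_lambda)
  fix r j :: "'n option"
  show "(\<lambda>\<xi> :: (real ^ 'n) ^ 'n option. case r of None \<Rightarrow> 1 | Some k \<Rightarrow> \<xi> $ j $ k) \<in> borel_measurable borel"
    by (cases r) simp_all
qed

text \<open>After the change of variables the integrand vanishes everywhere: where the determinant
  is 0 the weight is \<open>1 / 0 = 0\<close>, elsewhere the indicator is 0.\<close>

lemma AE_rho_nonzero: "AE \<xi> in lborel. rho (\<xi> :: (real ^ 'n) ^ 'n::finite option) \<noteq> 0"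
proof -
  have "(\<integral>\<^sup>+\<xi>. indicator {0} (rho (\<xi> :: (real ^ 'n) ^ 'n option)) \<partial>lborel) = 0"
    by (subst nn_integral_phase_inverse) (auto simp: rho_phase_inverse indicator_def intro!: nn_integral_zero')
  then have "AE \<xi> in lborel. indicator {0} (rho (\<xi> :: (real ^ 'n) ^ 'n option)) = (0 :: ennreal)"
    by (subst (asm) nn_integral_0_iff_AE) simp_all
  then show ?thesis
    by eventually_elim (auto simp: indicator_eq_0_iff)
qed

section \<open>The identity\<close>

lemma schroedinger_eq_integral:
  fixes f :: "real ^ 'n \<Rightarrow> complex"
  shows "schroedinger f x t = complex_of_real (1 / (2 * pi) ^ CARD('n)) * (\<integral>\<xi>. exp (\<i> * complex_of_real (x \<bullet> \<xi>)) *
    (exp (\<i> * complex_of_real (t * (norm \<xi>)\<^sup>2)) * fourier f \<xi>) \<partial>lborel)"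
  unfolding schroedinger_def by (simp add: distrib_left exp_add mult.assoc)

text \<open>With the times fixed, the phases in the squared norms move into the amplitudes. They are
  unimodular, so integrability persists, and Fubini splits the integral over the components.\<close>

lemma prod_schroedinger_eq_inverse_fourier:
  fixes f :: "'m::finite \<Rightarrow> real ^ 'n \<Rightarrow> complex" and X :: "(real ^ 'n) ^ 'm" and s :: "'m \<Rightarrow> real"
  assumes F: "\<And>j. integrable lborel (fourier (f j))"
  defines "H \<equiv> \<lambda>\<xi>. \<Prod>j\<in>UNIV. exp (\<i> * complex_of_real (s j * (norm (\<xi> $ j))\<^sup>2)) * fourier (f j) (\<xi> $ j)"
  shows "integrable lborel H"
    and "(\<Prod>j\<in>UNIV. schroedinger (f j) (X $ j) (s j)) = inverse_fourier H X"
proof -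
  have [measurable]: "fourier (f j) \<in> borel_measurable borel" for j
    using F by (auto dest: borel_measurable_integrable)
  let ?h = "\<lambda>j \<xi>. exp (\<i> * complex_of_real (s j * (norm \<xi>)\<^sup>2)) * fourier (f j) \<xi>"
  have h: "integrable lborel (?h j)" for j
    by (rule Bochner_Integration.integrable_bound[OF F[of j]]) (auto simp: norm_mult)
  then show "integrable lborel H"
    unfolding H_def by (rule integrable_vec_prod)
  have "exp (\<i> * complex_of_real (X \<bullet> \<xi>)) = (\<Prod>j\<in>UNIV. exp (\<i> * complex_of_real (X $ j \<bullet> \<xi> $ j)))" for \<xi>
    by (simp add: inner_vec_def sum_distrib_left flip: exp_sum)
  then have "inverse_fourier H X = complex_of_real (1 / (2 * pi) ^ (CARD('m) * CARD('n))) *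
     (\<integral>\<xi>. (\<Prod>j\<in>UNIV. exp (\<i> * complex_of_real (X $ j \<bullet> \<xi> $ j)) * ?h j (\<xi> $ j)) \<partial>lborel)"
    by (simp add: inverse_fourier_def H_def prod.distrib)
  also have "(\<integral>\<xi>. (\<Prod>j\<in>UNIV. exp (\<i> * complex_of_real (X $ j \<bullet> \<xi> $ j)) * ?h j (\<xi> $ j)) \<partial>lborel)
      = (\<Prod>j\<in>UNIV. \<integral>\<xi>. exp (\<i> * complex_of_real (X $ j \<bullet> \<xi>)) * ?h j \<xi> \<partial>lborel)"
    by (rule integral_vec_prod) (rule integrable_osc(1)[OF h])
  moreover have const: "complex_of_real (1 / (2 * pi) ^ (CARD('m) * CARD('n))) = complex_of_real (1 / (2 * pi) ^ CARD('n)) ^ CARD('m)"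
    by (simp only: of_real_power[symmetric] power_divide power_one power_mult[symmetric] mult.commute)
  ultimately show "(\<Prod>j\<in>UNIV. schroedinger (f j) (X $ j) (s j)) = inverse_fourier H X"
    by (simp only: schroedinger_eq_integral prod.distrib prod_constant const)
qed

theorem theorem1p5:
  fixes f :: "'n::finite option \<Rightarrow> real ^ 'n \<Rightarrow> complex"
    and u :: "'n option \<Rightarrow> real ^ 'n \<Rightarrow> real \<Rightarrow> complex"
    and \<sigma> :: real
  assumes "\<And>j. integrable lborel (fourier (f j))"
    and "\<And>j. AE x in lborel. f j x = inverse_fourier (fourier (f j)) x"
    and "\<And>j. u j = schroedinger (f j)"
    and "\<sigma> \<ge> 0"
    and "integrable lborel (\<lambda>\<xi> :: (real ^ 'n) ^ ('n option).
           complex_of_real (\<bar>rho \<xi>\<bar> powr \<sigma>) * (\<Prod>j\<in>UNIV. fourier (f j) (\<xi> $ j)))"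
  shows "(\<integral>\<^sup>+(x, t). ennreal ((cmod (rho_nabla_powr \<sigma>
              (\<lambda>X. \<Prod>j\<in>UNIV. u j (X $ j) (zero_sum t $ j)) (zero_sum x)))\<^sup>2)
            \<partial>(lborel :: (((real ^ 'n) ^ 'n) \<times> (real ^ 'n)) measure))
       = ennreal (1 / (2 ^ CARD('n) * (2 * pi) ^ (CARD('n) * (CARD('n) + 1)))) *
         (\<integral>\<^sup>+\<xi>. ennreal (\<Prod>j\<in>UNIV. (cmod (fourier (f j) (\<xi> $ j)))\<^sup>2)
                / ennreal (\<bar>rho \<xi>\<bar> powr (1 - 2 * \<sigma>))
            \<partial>(lborel :: ((real ^ 'n) ^ ('n option)) measure))"
proof -
  let ?D = "CARD('n) * (CARD('n) + 1)"
  let ?c = "1 / (2 * pi) ^ ?D"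
  define F where "F j = fourier (f j)" for j
  define m :: "(real ^ 'n) ^ 'n option \<Rightarrow> complex" where "m \<xi> = complex_of_real (\<bar>rho \<xi>\<bar> powr \<sigma>)" for \<xi>
  define K where "K \<xi> = m \<xi> * (\<Prod>j\<in>UNIV. F j (\<xi> $ j))" for \<xi>
  have [measurable]: "F j \<in> borel_measurable borel" for j
    using assms(1)[of j] by (auto simp: F_def dest: borel_measurable_integrable)
  have [measurable]: "m \<in> borel_measurable borel"
    unfolding m_def[abs_def] by measurable
  have K: "integrable lborel K"
    using assms(5) by (simp add: K_def[abs_def] m_def F_def)
  then have [measurable]: "K \<in> borel_measurable borel"
    by (auto dest: borel_measurable_integrable)
  have [measurable]: "(\<lambda>p :: (real ^ 'n ^ 'n) \<times> (real ^ 'n). fst p) \<in> borel_measurable borel"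
    by (intro borel_measurable_continuous_onI continuous_intros)
  define w where "w p = 1 / (2 ^ CARD('n) * \<bar>det (fst p)\<bar>)" for p :: "(real ^ 'n ^ 'n) \<times> (real ^ 'n)"
  have [measurable]: "w \<in> borel_measurable borel"
    unfolding w_def[abs_def] by measurable
  have w_nonneg: "0 \<le> w p" for p
    by (simp add: w_def)
  note pushforward = lborel_phase_inverse[where 'n = 'n, folded w_def]
  \<comment> \<open>With the Jacobian weight included, the multiplier expression on the subspace
    becomes a transform with respect to plain Lebesgue measure.\<close>
  define P where "P p = w p *\<^sub>R K (phase_inverse p)" for p
  have P: "integrable lborel P"
    using K unfolding P_def[abs_def]
    by (subst (asm) pushforward, subst (asm) integrable_distr_eq)
       (simp_all add: integrable_density w_nonneg)

  have osc: "rho_nabla_powr \<sigma> (\<lambda>X. \<Prod>j\<in>UNIV. u j (X $ j) (zero_sum t $ j)) (zero_sum x)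
      = complex_of_real ?c * osc_integral P (x, t)" for x t
  proof -
    \<comment> \<open>For fixed \<open>t\<close> the product of solutions is, as a function of
      \<open>X\<close>, the inverse transform of the integrable \<open>H\<close>; hence
      \<open>fourier\<close> of it is \<open>H\<close> almost everywhere, even if the product is not
      integrable.\<close>
    define H where "H \<xi> = (\<Prod>j\<in>UNIV. exp (\<i> * complex_of_real (zero_sum t $ j * (norm (\<xi> $ j))\<^sup>2)) * F j (\<xi> $ j))"
      for \<xi> :: "(real ^ 'n) ^ 'n option"
    define G where "G X = (\<Prod>j\<in>UNIV. u j (X $ j) (zero_sum t $ j))" for X
    have H: "integrable lborel H" and G: "G X = inverse_fourier H X" for X
      using prod_schroedinger_eq_inverse_fourier[where f = f and s = "\<lambda>j. zero_sum t $ j", OF assms(1)]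
      by (simp_all add: H_def[abs_def] G_def assms(3) F_def)
    have [measurable]: "H \<in> borel_measurable borel"
      using H by (auto dest: borel_measurable_integrable)
    note [measurable] = fourier_inverse_fourier(1)[OF H, of G]
    let ?\<phi> = "\<lambda>\<xi>. zero_sum x \<bullet> \<xi> + (\<Sum>j\<in>UNIV. zero_sum t $ j * (norm (\<xi> $ j))\<^sup>2)"
    have mH: "exp (\<i> * complex_of_real (zero_sum x \<bullet> \<xi>)) * (m \<xi> * H \<xi>) = exp (\<i> * complex_of_real (?\<phi> \<xi>)) * K \<xi>" for \<xi>
      by (simp add: H_def K_def prod.distrib distrib_left sum_distrib_left exp_add exp_sum)
    have "rho_nabla_powr \<sigma> G (zero_sum x) = inverse_fourier (\<lambda>\<xi>. m \<xi> * fourier G \<xi>) (zero_sum x)"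
      by (simp add: rho_nabla_powr_def fourier_multiplier_def m_def)
    also have "\<dots> = inverse_fourier (\<lambda>\<xi>. m \<xi> * H \<xi>) (zero_sum x)"
      unfolding inverse_fourier_eq_osc_integral
      by (subst osc_integral_cong_AE[where Q = "\<lambda>\<xi>. m \<xi> * H \<xi>"])
         (use fourier_inverse_fourier[OF H, of G] G in auto)
    also have "\<dots> = complex_of_real ?c * (\<integral>\<xi>. exp (\<i> * complex_of_real (?\<phi> \<xi>)) * K \<xi> \<partial>lborel)"
      unfolding inverse_fourier_def mH by (simp add: mult.commute)
    also have "(\<integral>\<xi>. exp (\<i> * complex_of_real (?\<phi> \<xi>)) * K \<xi> \<partial>lborel)
        = (\<integral>p. w p *\<^sub>R (exp (\<i> * complex_of_real (?\<phi> (phase_inverse p))) * K (phase_inverse p)) \<partial>lborel)"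
      by (subst pushforward, subst integral_distr) (simp_all add: integral_density w_nonneg)
    also have "\<dots> = osc_integral P (x, t)"
      unfolding osc_integral_def
    proof (rule Bochner_Integration.integral_cong[OF refl])
      fix p :: "(real ^ 'n ^ 'n) \<times> (real ^ 'n)"
      show "w p *\<^sub>R (exp (\<i> * complex_of_real (?\<phi> (phase_inverse p))) * K (phase_inverse p))
          = exp (\<i> * complex_of_real ((x, t) \<bullet> p)) * P p"
      \<comment> \<open>In the singular case, where \<open>phase_eq\<close> does not apply,
        \<open>w p\<close> is \<open>1 / 0 = 0\<close> and both sides vanish.\<close>
      proof (cases "det (fst p) = 0")
        case True
        then show ?thesis
          by (simp add: P_def w_def)
      next
        case False
        then have "?\<phi> (phase_inverse p) = (x, t) \<bullet> p"
          using phase_eq[of "fst p" x "snd p" t] by simp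
        then show ?thesis
          by (simp add: P_def)
      qed
    qed
    finally show ?thesis
      unfolding G_def .
  qed

  have P_eq: "(\<integral>\<^sup>+p. ennreal ((cmod (P p))\<^sup>2) \<partial>lborel)
      = ennreal (1 / 2 ^ CARD('n)) * (\<integral>\<^sup>+\<xi>. ennreal (\<Prod>j\<in>UNIV. (cmod (F j (\<xi> $ j)))\<^sup>2)
                / ennreal (\<bar>rho \<xi>\<bar> powr (1 - 2 * \<sigma>)) \<partial>lborel)"
  proof -
    let ?g = "\<lambda>\<xi>. ennreal (1 / (2 ^ CARD('n) * \<bar>rho \<xi>\<bar>) * (cmod (K \<xi>))\<^sup>2)"
    have "(\<integral>\<^sup>+p. ennreal ((cmod (P p))\<^sup>2) \<partial>lborel) = (\<integral>\<^sup>+p. ennreal (w p) * ?g (phase_inverse p) \<partial>lborel)"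
    proof (rule nn_integral_cong)
      fix p
      have "(cmod (P p))\<^sup>2 = w p * (w p * (cmod (K (phase_inverse p)))\<^sup>2)"
        by (simp add: P_def power_mult_distrib power2_eq_square)
      then show "ennreal ((cmod (P p))\<^sup>2) = ennreal (w p) * ?g (phase_inverse p)"
        using w_nonneg[of p] by (simp only: w_def rho_phase_inverse ennreal_mult'[symmetric])
    qed
    also have "\<dots> = (\<integral>\<^sup>+\<xi>. ?g \<xi> \<partial>lborel)"
      unfolding w_def by (rule nn_integral_phase_inverse[symmetric]) measurable
    also have "\<dots> = (\<integral>\<^sup>+\<xi>. ennreal (1 / 2 ^ CARD('n)) * (ennreal (\<Prod>j\<in>UNIV. (cmod (F j (\<xi> $ j)))\<^sup>2)
                / ennreal (\<bar>rho \<xi>\<bar> powr (1 - 2 * \<sigma>))) \<partial>lborel)"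
    proof (rule nn_integral_cong_AE)
      show "AE \<xi> in lborel. ?g \<xi> = ennreal (1 / 2 ^ CARD('n)) * (ennreal (\<Prod>j\<in>UNIV. (cmod (F j (\<xi> $ j)))\<^sup>2)
                / ennreal (\<bar>rho \<xi>\<bar> powr (1 - 2 * \<sigma>)))"
        using AE_rho_nonzero
      proof eventually_elim
        case (elim \<xi>)
        let ?p = "\<Prod>j\<in>UNIV. (cmod (F j (\<xi> $ j)))\<^sup>2"
        \<comment> \<open>Writing 2 \<sigma> as 1 - (1 - 2 \<sigma>) isolates a first power of
          |rho|, which cancels the Jacobian left in \<open>?g\<close>; this needs rho to be
          nonzero.\<close>
        have "(\<bar>rho \<xi>\<bar> powr \<sigma>)\<^sup>2 = \<bar>rho \<xi>\<bar> / \<bar>rho \<xi>\<bar> powr (1 - 2 * \<sigma>)"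
          using elim by (simp add: powr_diff powr_power)
        then have "(cmod (K \<xi>))\<^sup>2 = \<bar>rho \<xi>\<bar> / \<bar>rho \<xi>\<bar> powr (1 - 2 * \<sigma>) * ?p"
          by (simp add: K_def m_def norm_mult power_mult_distrib prod_power_distrib flip: prod_norm)
        then have g: "1 / (2 ^ CARD('n) * \<bar>rho \<xi>\<bar>) * (cmod (K \<xi>))\<^sup>2 = 1 / 2 ^ CARD('n) * (?p / \<bar>rho \<xi>\<bar> powr (1 - 2 * \<sigma>))"
          using elim by simp
        have "?g \<xi> = ennreal (1 / 2 ^ CARD('n)) * ennreal (?p / \<bar>rho \<xi>\<bar> powr (1 - 2 * \<sigma>))"
          unfolding g by (rule ennreal_mult) (simp_all add: prod_nonneg)
        also have "ennreal (?p / \<bar>rho \<xi>\<bar> powr (1 - 2 * \<sigma>)) = ennreal ?p / ennreal (\<bar>rho \<xi>\<bar> powr (1 - 2 * \<sigma>))"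
          using elim by (intro divide_ennreal[symmetric]) (simp_all add: prod_nonneg)
        finally show ?case .
      qed
    qed
    finally show ?thesis
      by (subst (asm) nn_integral_cmult) simp_all
  qed

  have ennreal_mult3: "ennreal (a * b * e) = ennreal a * ennreal b * ennreal e"
    if "a \<ge> 0" "b \<ge> 0" "e \<ge> 0" for a b e :: real
    using that by (simp add: ennreal_mult)
  have "(\<integral>\<^sup>+(x, t). ennreal ((cmod (rho_nabla_powr \<sigma>
              (\<lambda>X. \<Prod>j\<in>UNIV. u j (X $ j) (zero_sum t $ j)) (zero_sum x)))\<^sup>2) \<partial>lborel)
      = (\<integral>\<^sup>+p. ennreal (?c\<^sup>2) * ennreal ((cmod (osc_integral P p))\<^sup>2) \<partial>lborel)"
    by (intro nn_integral_cong)
       (simp only: case_prod_unfold osc prod.collapse norm_mult norm_of_real power_mult_distrib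
         power2_abs ennreal_mult zero_le_power2)
  \<comment> \<open>The space of pairs (x, t) has dimension d * d + d, which is the exponent
    \<open>?D\<close>.\<close>
  also have "\<dots> = ennreal (?c\<^sup>2) * (ennreal ((2 * pi) ^ ?D) * (\<integral>\<^sup>+p. ennreal ((cmod (P p))\<^sup>2) \<partial>lborel))"
    using P by (subst nn_integral_cmult) (simp_all add: plancherel borel_measurable_integrable add.commute)
  also have "\<dots> = ennreal (?c\<^sup>2 * (2 * pi) ^ ?D * (1 / 2 ^ CARD('n))) * (\<integral>\<^sup>+\<xi>. ennreal (\<Prod>j\<in>UNIV. (cmod (F j (\<xi> $ j)))\<^sup>2)
                / ennreal (\<bar>rho \<xi>\<bar> powr (1 - 2 * \<sigma>)) \<partial>lborel)"
    unfolding P_eq by (subst ennreal_mult3) (simp_all add: mult.assoc)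
  also have "?c\<^sup>2 * (2 * pi) ^ ?D * (1 / 2 ^ CARD('n)) = 1 / (2 ^ CARD('n) * (2 * pi) ^ ?D)"
    by (simp add: power2_eq_square)
  finally show ?thesis
    unfolding F_def .
qed

end
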